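(* For any $[0,1]$-valued sequence $(q_n)_{n\ge 0}$, $$\frac{h(T_{n,q_n})}{n(1-q_n)+c^*\log n}\longrightarrow 1\qquad (n\to\infty)$$ in probability and in $L_p$ for every $p>0$.
   Context: Let $T_\infty=\bigcup_{k\ge 0}\{\overline 0,\overline 1\}^k$ be the complete infinite rooted binary tree: nodes are finite strings over $\{\overline 0,\overline 1\}$, the root is the empty string $\varnothing$, the node $u$ has left child $u\overline 0$ and right child $u\overline 1$, and $|u|$ (the depth of $u$) is the length of $u$. For a set $V\subset T_\infty$ write $uV=\{uv:v\in V\}$. A tree is a connected subset of $T_\infty$; its height is $h(T)=\sup_{u\in T}|u|-\inf_{u\in T}|u|$. For a finite sequence $f=(f(1),\dots,f(n))$ of distinct positive integers, the binary search tree $T\langle f\rangle\subset T_\infty$ is defined inductively: $T\langle f\rangle=\emptyset$ if $n=0$; otherwise $T\langle f\rangle=\{\varnothing\}\cup \overline 0\,T\langle f^-\rangle\cup\overline 1\,T\langle f^+\rangle$, where $f^-$ (resp. $f^+$) is the subsequence of terms $f(i)<f(1)$ (resp. $f(i)>f(1)$), in the same order as in $f$. For $n\ge 0$ and $q\in[0,1]$, the Mallows distribution $\pi_{n,q}$ on the symmetric group $\mathcal S_n$ gives each $\sigma$ probability proportional to $q^{\mathrm{Inv}(\sigma)}$, where $\mathrm{Inv}(\sigma)=|\{i<j:\sigma(i)>\sigma(j)\}|$ (with $0^0=1$, so that $\pi_{n,0}$ is concentrated on the identity). $T_{n,q}$ denotes a random tree distributed as $T\langle\sigma\rangle$ with $\sigma\sim\pi_{n,q}$.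 $c^*=4.311\ldots$ is the unique solution of $c\log(2e/c)=1$ with $c\ge 2$. *)

theory Defs
  imports "HOL-Probability.Probability" "HOL-Combinatorics.Permutations"
begin

section \<open>Binary search trees\<close>

text \<open>Nodes of the infinite binary tree are lists over \<^typ>\<open>bool\<close>, read from the root;
  \<^const>\<open>False\<close> is a step to the left child and \<^const>\<open>True\<close> a step to the right child.\<close>

type_synonym node = "bool list"

function search_tree :: "nat list \<Rightarrow> node set" where
  "search_tree [] = {}"
| "search_tree (x # xs) =
     {[]} \<union> (\<lambda>v. False # v) ` search_tree (filter (\<lambda>y. y < x) xs)
          \<union> (\<lambda>v. True # v) ` search_tree (filter (\<lambda>y. y > x) xs)"
  by pat_completeness auto
termination
  by (relation "Wellfounded.measure length") (auto simp: less_Suc_eq_le)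

text \<open>Suprema in \<^typ>\<open>nat\<close> are meaningful for bounded sets only, so this is the height for trees
  of finite height, such as the finite trees \<^term>\<open>search_tree f\<close>. The height of the empty tree is \<open>0\<close>.\<close>

definition tree_height :: "node set \<Rightarrow> nat" where
  "tree_height T = (SUP u\<in>T. length u) - (INF u\<in>T. length u)"

lemma finite_search_tree: "finite (search_tree f)"
  by (induction f rule: search_tree.induct) auto


section \<open>The Mallows distribution\<close>

text \<open>The symmetric group on \<open>{1..n}\<close> consists of the functions \<open>\<sigma>\<close> with
  \<^term>\<open>\<sigma> permutes {1..n::nat}\<close>; these are the identity outside \<open>{1..n}\<close>.\<close>

definition Inv :: "nat \<Rightarrow> (nat \<Rightarrow> nat) \<Rightarrow> nat" where
  "Inv n \<sigma> = card {(i, j). i \<in> {1..n} \<and> j \<in> {1..n} \<and> i < j \<and> \<sigma> i > \<sigma> j}"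

definition mallows_Z :: "nat \<Rightarrow> real \<Rightarrow> real" where
  "mallows_Z n q = (\<Sum>\<sigma> | \<sigma> permutes {1..n}. q ^ Inv n \<sigma>)"

definition mallows :: "nat \<Rightarrow> real \<Rightarrow> (nat \<Rightarrow> nat) pmf" where
  "mallows n q =
     embed_pmf (\<lambda>\<sigma>. if \<sigma> permutes {1..n} then q ^ Inv n \<sigma> / mallows_Z n q else 0)"

lemma Inv_id [simp]: "Inv n id = 0"
proof -
  have "{(i, j). i \<in> {1..n} \<and> j \<in> {1..n} \<and> i < j \<and> id i > id j} = {}"
    by auto
  then show ?thesis
    unfolding Inv_def by (simp only: card.empty)
qed

lemma mallows_Z_pos:
  assumes "q \<ge> 0"
  shows "mallows_Z n q > 0"
proof -
  have "(1::real) = q ^ Inv n id"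
    by simp
  also have "\<dots> \<le> mallows_Z n q"
    unfolding mallows_Z_def
    by (rule member_le_sum) (use assms permutes_id[of "{1..n}"] in \<open>simp_all add: finite_permutations id_def\<close>)
  finally show ?thesis
    by simp
qed

lemma pmf_mallows:
  assumes "q \<ge> 0"
  shows "pmf (mallows n q) \<sigma> =
           (if \<sigma> permutes {1..n} then q ^ Inv n \<sigma> / mallows_Z n q else 0)"
  unfolding mallows_def
proof (rule pmf_embed_pmf)
  let ?f = "\<lambda>\<sigma>. if \<sigma> permutes {1..n} then q ^ Inv n \<sigma> / mallows_Z n q else 0"
  let ?S = "{\<sigma>. \<sigma> permutes {1..n}}"
  have fin: "finite ?S"
    by (simp add: finite_permutations)
  show nonneg: "0 \<le> ?f \<sigma>" for \<sigma>
    using assms mallows_Z_pos[OF assms, of n] by simp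
  have "(\<integral>\<^sup>+\<sigma>. ennreal (?f \<sigma>) \<partial>count_space UNIV) = (\<Sum>\<sigma>\<in>?S. ennreal (?f \<sigma>))"
    by (rule nn_integral_count_space'[OF fin]) auto
  also have "\<dots> = ennreal (\<Sum>\<sigma>\<in>?S. ?f \<sigma>)"
    by (intro sum_ennreal nonneg)
  also have "(\<Sum>\<sigma>\<in>?S. ?f \<sigma>) = (\<Sum>\<sigma>\<in>?S. q ^ Inv n \<sigma>) / mallows_Z n q"
    by (simp add: sum_divide_distrib)
  also have "\<dots> = 1"
    using mallows_Z_pos[OF assms, of n] by (simp add: mallows_Z_def)
  finally show "(\<integral>\<^sup>+\<sigma>. ennreal (?f \<sigma>) \<partial>count_space UNIV) = 1"
    by simp
qed

definition mallows_tree :: "nat \<Rightarrow> real \<Rightarrow> node set pmf" where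
  "mallows_tree n q = map_pmf (\<lambda>\<sigma>. search_tree (map \<sigma> [1..<Suc n])) (mallows n q)"


section \<open>The constant $c^*$\<close>

definition c_star :: real where
  "c_star = (THE c. c \<ge> 2 \<and> c * ln (2 * exp 1 / c) = 1)"

lemma c_star_unique: "\<exists>!c::real. c \<ge> 2 \<and> c * ln (2 * exp 1 / c) = 1"
proof -
  define g where "g = (\<lambda>c::real. c * (ln 2 + 1 - ln c))"
  have g: "c * ln (2 * exp 1 / c) = g c" if "c \<ge> 2" for c
    using that by (simp add: g_def ln_div ln_mult)
  have deriv: "(g has_real_derivative ln 2 - ln x) (at x)" if "x \<ge> 2" for x
    unfolding g_def using that by (auto intro!: derivative_eq_intros simp: field_simps)
  have decr: "g y < g x" if "2 \<le> x" "x < y" for x y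
  proof (rule DERIV_neg_imp_decreasing_open[OF that(2)])
    show "\<exists>d. (g has_real_derivative d) (at t) \<and> d < 0" if "x < t" "t < y" for t
      using deriv[of t] that \<open>2 \<le> x\<close> by (intro exI[of _ "ln 2 - ln t"]) auto
    show "continuous_on {x..y} g"
      using deriv \<open>2 \<le> x\<close> by (intro DERIV_continuous_on[of _ g "\<lambda>t. ln 2 - ln t"])
        (auto intro: has_field_derivative_at_within)
  qed
  have "\<exists>c\<ge>2. c \<le> 2 * exp 1 \<and> g c = 1"
  proof (rule IVT2')
    show "g (2 * exp 1) \<le> 1" "1 \<le> g 2"
      by (simp_all add: g_def ln_mult)
    show "continuous_on {2..2 * exp 1} g"
      using deriv by (intro DERIV_continuous_on[of _ g "\<lambda>t. ln 2 - ln t"])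
        (auto intro: has_field_derivative_at_within)
  qed simp
  then obtain c where c: "c \<ge> 2" "g c = 1"
    by blast
  show ?thesis
  proof (rule ex1I[of _ c])
    show "c \<ge> 2 \<and> c * ln (2 * exp 1 / c) = 1"
      using c g by simp
    show "d = c" if "d \<ge> 2 \<and> d * ln (2 * exp 1 / d) = 1" for d
      using that c g[of d] decr[of c d] decr[of d c] by (cases d c rule: linorder_cases) auto
  qed
qed


section \<open>Convergence to a constant\<close>

text \<open>As the limit is a constant, the \<open>n\<close>-th random variable may live on its own
  probability space \<^term>\<open>M n\<close>.\<close>

definition tendsto_in_probability ::
    "(nat \<Rightarrow> 'a measure) \<Rightarrow> (nat \<Rightarrow> 'a \<Rightarrow> real) \<Rightarrow> real \<Rightarrow> bool" where
  "tendsto_in_probability M X c \<longleftrightarrow>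
     (\<forall>n. X n \<in> borel_measurable (M n)) \<and>
     (\<forall>\<epsilon>>0. (\<lambda>n. measure (M n) {x \<in> space (M n). \<bar>X n x - c\<bar> > \<epsilon>}) \<longlonglongrightarrow> 0)"

definition tendsto_in_Lp ::
    "real \<Rightarrow> (nat \<Rightarrow> 'a measure) \<Rightarrow> (nat \<Rightarrow> 'a \<Rightarrow> real) \<Rightarrow> real \<Rightarrow> bool" where
  "tendsto_in_Lp p M X c \<longleftrightarrow>
     (\<forall>n. X n \<in> borel_measurable (M n)) \<and>
     (\<forall>n. integrable (M n) (\<lambda>x. \<bar>X n x\<bar> powr p)) \<and>
     (\<lambda>n. \<integral>x. \<bar>X n x - c\<bar> powr p \<partial>M n) \<longlonglongrightarrow> 0"

end

theory Submission
  imports Defs "HOL-Combinatorics.Multiset_Permutations" "HOL-Real_Asymp.Real_Asymp"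
begin

text \<open>Write \<open>t = 1 - q\<close> and \<open>L = n t + c\<^sup>* ln n\<close>. Everything rests on one recursion. The first entry of a
  Mallows permutation of \<open>{1..n}\<close> equals \<open>j + 1\<close> with probability proportional to \<open>q ^ j\<close>, and,
  given this entry, the smaller and the larger entries form independent Mallows permutations of
  sizes \<open>j\<close> and \<open>n - 1 - j\<close>. Hence the distribution function \<open>F\<close> of the number of levels of the tree
  satisfies \<open>F (m + 1) n = (\<Sum>j<n. p j * F m j * F m (n - 1 - j))\<close>, where \<open>p\<close> is a truncated geometric
  distribution (\<open>prob_mallows_levels_less\<close>). All later estimates are comparison arguments for
  this recursion, uniform in \<open>q\<close>.

  The two summands of \<open>L\<close> come from two parts of the tree. While the current size \<open>N\<close> satisfies
  \<open>N t \<gg> 1\<close>, the tree is essentially a path to the right: each step along the right spine removes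
  about \<open>1 / t\<close> entries and leaves the rest, so that about \<open>n t\<close> levels are needed to get down to
  \<open>N t \<approx> 1\<close>. When \<open>N t\<close> is small, the first entry is almost uniform and the tree behaves like a
  random binary search tree, whose height is \<open>c\<^sup>* ln N\<close>.

  Upper bound. The function \<open>n powr \<alpha> * (1 + \<gamma> t) ^ n\<close> is a supersolution of the linearised
  recursion with a factor arbitrarily close to \<open>2 / (\<alpha> + 1)\<close> per level
  (\<open>height_tail_potential\<close>); the choice \<open>\<alpha> = c\<^sup>* - 1\<close> makes the resulting bound sharp for subtrees
  with \<open>N t = o(L)\<close>. The left subtrees hanging off the right spine all have this property, up to
  an exponentially small probability, and a union bound over the spine together with a Chernoff
  bound for its length gives the upper tail (\<open>spine_upper\<close>, \<open>height_upper_tail\<close>).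

  Lower bound. For \<open>c < c\<^sup>*\<close> the expected number of nodes \<open>l\<close> levels down whose subtrees have size
  at least \<open>exp (- l / c)\<close> times the original one exceeds \<open>1\<close> once \<open>l\<close> is large. This
  supercriticality propagates a positive lower bound on the probability of height at least
  \<open>c ln N\<close> through all scales with \<open>N t \<le> \<delta>\<close> (\<open>height_tail_block\<close>, \<open>height_tail_positive\<close>). Since a
  somewhat larger tree contains many independent subtrees of a given size, the probability is then
  raised to nearly \<open>1\<close> (\<open>height_cdf_boost\<close>). Finally, about \<open>n t\<close> steps along the right spine still
  leave a subtree of size \<open>n powr (1 - \<epsilon>)\<close> (\<open>spine_lower\<close>, \<open>height_lower_tail\<close>).

  Both tails together give convergence in probability. For convergence in \<open>L\<^sub>p\<close>, the supersolution also
  shows that the height exceeds \<open>B L\<close> with probability at most \<open>n powr - (p + 1)\<close> for some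
  constant \<open>B\<close>, and the height never exceeds \<open>n\<close> (\<open>height_ratio_moment_bound\<close>).\<close>


section \<open>Levels of a binary search tree\<close>

text \<open>The number of levels is one more than the height of a nonempty tree and \<open>0\<close> for the empty tree.
  With this convention a nonempty tree always has one level more than the higher one of its two
  subtrees, even if these are empty.\<close>
function levels :: "nat list \<Rightarrow> nat" where
  "levels [] = 0"
| "levels (x # xs) =
     Suc (max (levels (filter (\<lambda>y. y < x) xs)) (levels (filter (\<lambda>y. y > x) xs)))"
  by pat_completeness auto
termination
  by (relation "Wellfounded.measure length") (auto simp: less_Suc_eq_le)

lemma search_tree_lengths_less_iff:
  "(\<forall>u\<in>search_tree f. length u < m) \<longleftrightarrow> levels f \<le> m"
proof (induction f arbitrary: m rule: levels.induct)
  case (2 x xs)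
  show ?case
  proof (cases m)
    case (Suc k)
    have "(\<forall>u\<in>search_tree (x # xs). length u < m) \<longleftrightarrow>
          (\<forall>u\<in>search_tree (filter (\<lambda>y. y < x) xs). length u < k) \<and>
          (\<forall>u\<in>search_tree (filter (\<lambda>y. y > x) xs). length u < k)"
      by (simp add: Suc ball_Un)
    then show ?thesis
      by (simp add: 2 Suc)
  qed auto
qed auto

lemma tree_height_search_tree: "tree_height (search_tree f) = levels f - 1"
proof (cases f)
  case (Cons x xs)
  define S where "S = length ` search_tree f"
  have fin: "finite S" and ne: "S \<noteq> {}"
    by (auto simp: S_def finite_search_tree Cons)
  have zero: "Inf S = 0"
  proof -
    have "0 \<in> S"
      by (force simp: S_def Cons)
    then show ?thesis
      by (metis cInf_lower bdd_below_bot le_zero_eq)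
  qed
  have iff: "(\<forall>k\<in>S. k < m) \<longleftrightarrow> levels f \<le> m" for m
    using search_tree_lengths_less_iff[of f m] by (simp add: S_def)
  have "Sup S < m \<longleftrightarrow> levels f \<le> m" for m
    using iff[of m] Max_less_iff[OF fin ne, of m] cSup_eq_Max[OF fin ne] by simp
  from this[of "levels f"] this[of "Suc (Sup S)"] have "Suc (Sup S) = levels f"
    by linarith
  then show ?thesis
    by (simp add: tree_height_def zero flip: S_def)
qed (simp add: tree_height_def)

lemma levels_le_length: "levels xs \<le> length xs"
proof (induction xs rule: levels.induct)
  case (2 x xs)
  have "levels (filter P xs) \<le> length xs" if "levels (filter P xs) \<le> length (filter P xs)" for P
    using that length_filter_le[of P xs] by linarith
  with 2 show ?case by simp
qed simp

section \<open>Inversions and interleavings\<close>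

text \<open>The number of inversions, grouped by the first entry involved: the first entry of the list becomes the
  root of the search tree, and the number of smaller entries is the size of the left subtree.\<close>
primrec list_inv :: "nat list \<Rightarrow> nat" where
  "list_inv [] = 0"
| "list_inv (x # xs) = length (filter (\<lambda>y. y < x) xs) + list_inv xs"

text \<open>The Gaussian binomial coefficient of \<open>a + b\<close> over \<open>a\<close>: the generating function, by inversions, of the
  interleavings of \<open>a\<close> small and \<open>b\<close> large entries. A small first entry causes no inversion, a large
  one is inverted with all \<open>a\<close> small entries.\<close>
fun qbinom :: "real \<Rightarrow> nat \<Rightarrow> nat \<Rightarrow> real" where
  "qbinom q 0 b = 1"
| "qbinom q (Suc a) 0 = 1"
| "qbinom q (Suc a) (Suc b) = qbinom q a (Suc b) + q ^ Suc a * qbinom q (Suc a) b"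

lemma length_filter_shuffles:
  assumes "xs \<in> shuffles ys zs"
  shows "length (filter P xs) = length (filter P ys) + length (filter P zs)"
  using assms filter_shuffles[of P ys zs] length_shuffles by blast

text \<open>Inversions of an interleaving are those inside either list and those between the lists. The
  latter depend on the pattern of the interleaving only, so the weight of the two lists factors out.\<close>
lemma sum_shuffles_inversions:
  assumes "\<And>y z. y \<in> set ys \<Longrightarrow> z \<in> set zs \<Longrightarrow> y < z"
  shows "(\<Sum>xs\<in>shuffles ys zs. q ^ list_inv xs) =
           q ^ (list_inv ys + list_inv zs) * qbinom q (length ys) (length zs)"
  using assms
proof (induction ys zs rule: shuffles.induct)
  case (1 ys)
  show ?case by (cases ys) auto
next
  case (2 xs)
  show ?case by (cases xs) auto
next
  case (3 y ys z zs)
  have yz: "y < z"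
    using 3(3) by simp
  have disj: "(#) y ` shuffles ys (z # zs) \<inter> (#) z ` shuffles (y # ys) zs = {}"
    using yz by auto
  have A: "list_inv (y # xs) = length (filter (\<lambda>v. v < y) ys) + list_inv xs"
    if "xs \<in> shuffles ys (z # zs)" for xs
  proof -
    have "filter (\<lambda>v. v < y) (z # zs) = []"
      using 3(3) by (force simp: filter_empty_conv)
    then show ?thesis
      using length_filter_shuffles[OF that, of "\<lambda>v. v < y"] by simp
  qed
  have B: "list_inv (z # xs) = Suc (length ys) + length (filter (\<lambda>v. v < z) zs) + list_inv xs"
    if "xs \<in> shuffles (y # ys) zs" for xs
  proof -
    have "filter (\<lambda>v. v < z) (y # ys) = y # ys"
      using 3(3) by (force simp: filter_id_conv)
    then show ?thesis
      using length_filter_shuffles[OF that, of "\<lambda>v. v < z"] by simp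
  qed
  have "(\<Sum>xs\<in>shuffles (y # ys) (z # zs). q ^ list_inv xs) =
        (\<Sum>xs\<in>shuffles ys (z # zs). q ^ list_inv (y # xs)) +
        (\<Sum>xs\<in>shuffles (y # ys) zs. q ^ list_inv (z # xs))"
    using disj by (simp add: sum.union_disjoint sum.reindex del: list_inv.simps)
  also have "(\<Sum>xs\<in>shuffles ys (z # zs). q ^ list_inv (y # xs)) =
      (\<Sum>xs\<in>shuffles ys (z # zs). q ^ length (filter (\<lambda>v. v < y) ys) * q ^ list_inv xs)"
    by (rule sum.cong[OF refl]) (simp only: A power_add)
  also have "\<dots> = q ^ length (filter (\<lambda>v. v < y) ys) *
      (q ^ (list_inv ys + list_inv (z # zs)) * qbinom q (length ys) (length (z # zs)))"
    unfolding sum_distrib_left[symmetric] using 3(3) by (subst 3(1)) auto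
  also have "(\<Sum>xs\<in>shuffles (y # ys) zs. q ^ list_inv (z # xs)) =
      (\<Sum>xs\<in>shuffles (y # ys) zs.
         q ^ (Suc (length ys) + length (filter (\<lambda>v. v < z) zs)) * q ^ list_inv xs)"
    by (rule sum.cong[OF refl]) (simp only: B power_add)
  also have "\<dots> = q ^ (Suc (length ys) + length (filter (\<lambda>v. v < z) zs)) *
      (q ^ (list_inv (y # ys) + list_inv zs) * qbinom q (length (y # ys)) (length zs))"
    unfolding sum_distrib_left[symmetric] using 3(3) by (subst 3(2)) auto
  finally show ?case
    by (simp add: power_add algebra_simps)
qed

definition weighted_sum :: "real \<Rightarrow> nat set \<Rightarrow> (nat list \<Rightarrow> real) \<Rightarrow> real" where
  "weighted_sum q A g = (\<Sum>xs\<in>permutations_of_set A. q ^ list_inv xs * g xs)"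

lemma sum_permutations_of_set_Cons:
  fixes h :: "nat list \<Rightarrow> real"
  assumes "finite A" "A \<noteq> {}"
  shows "sum h (permutations_of_set A) =
           (\<Sum>x\<in>A. \<Sum>xs\<in>permutations_of_set (A - {x}). h (x # xs))"
proof -
  have "sum h (permutations_of_set A) =
        (\<Sum>x\<in>A. sum h ((#) x ` permutations_of_set (A - {x})))"
    unfolding permutations_of_set_nonempty[OF assms(2)]
    by (rule sum.UNION_disjoint) (use assms in auto)
  also have "\<dots> = (\<Sum>x\<in>A. \<Sum>xs\<in>permutations_of_set (A - {x}). h (x # xs))"
    by (rule sum.cong[OF refl]) (simp add: sum.reindex)
  finally show ?thesis .
qed

text \<open>This is the independence of the left and the right subtree: the total weight factors into contributions of
  the smaller and of the larger entries, because a list is determined by these two sublists and by the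
  way they are interleaved.\<close>
lemma weighted_sum_split:
  assumes fin: "finite A1" "finite A2"
    and A1: "\<And>y. y \<in> A1 \<Longrightarrow> y < x" and A2: "\<And>y. y \<in> A2 \<Longrightarrow> y > x"
  shows "weighted_sum q (A1 \<union> A2) (\<lambda>xs. g1 (filter (\<lambda>y. y < x) xs) * g2 (filter (\<lambda>y. y > x) xs)) =
           qbinom q (card A1) (card A2) * weighted_sum q A1 g1 * weighted_sum q A2 g2"
proof -
  define S where "S = permutations_of_set (A1 \<union> A2)"
  define T where "T = permutations_of_set A1 \<times> permutations_of_set A2"
  define p where "p = (\<lambda>xs. (filter (\<lambda>y. y < x) xs, filter (\<lambda>y. y > x) xs))"
  have pS: "p ` S \<subseteq> T"
    using A1 A2 by (force simp: p_def S_def T_def permutations_of_set_def)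
  have fiber: "{xs \<in> S. p xs = (ys, zs)} = shuffles ys zs" if T: "(ys, zs) \<in> T" for ys zs
  proof (intro equalityI subsetI)
    fix xs assume "xs \<in> {xs \<in> S. p xs = (ys, zs)}"
    then have xs: "set xs = A1 \<union> A2" "ys = filter (\<lambda>y. y < x) xs" "zs = filter (\<lambda>y. y > x) xs"
      by (auto simp: S_def p_def permutations_of_set_def)
    have "zs = filter (\<lambda>y. \<not> y < x) xs"
      unfolding xs(3) using A1 A2 xs(1) by (intro filter_cong) force+
    then show "xs \<in> shuffles ys zs"
      using partition_in_shuffles[of xs "\<lambda>y. y < x"] xs(2) by simp
  next
    fix xs assume xs: "xs \<in> shuffles ys zs"
    from T have T': "set ys = A1" "set zs = A2" "distinct ys" "distinct zs"
      by (auto simp: T_def permutations_of_set_def)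
    have disj: "set ys \<inter> set zs = {}"
      using A1 A2 T' by force
    have set: "set xs = A1 \<union> A2"
      using set_shuffles[OF xs] T' by simp
    have "filter (\<lambda>y. y < x) xs = filter (\<lambda>y. y \<in> set ys) xs"
      using set A1 A2 T' by (intro filter_cong) force+
    moreover have "filter (\<lambda>y. y > x) xs = filter (\<lambda>y. y \<notin> set ys) xs"
      using set A1 A2 T' by (intro filter_cong) force+
    ultimately have "p xs = (ys, zs)"
      using filter_shuffles_disjoint1[OF disj xs] by (simp add: p_def)
    then show "xs \<in> {xs \<in> S. p xs = (ys, zs)}"
      using distinct_disjoint_shuffles[OF T'(3,4) disj xs] set
      by (simp add: S_def permutations_of_set_def)
  qed
  have "weighted_sum q (A1 \<union> A2) (\<lambda>xs. g1 (filter (\<lambda>y. y < x) xs) * g2 (filter (\<lambda>y. y > x) xs)) =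
        (\<Sum>xs\<in>S. q ^ list_inv xs * (g1 (fst (p xs)) * g2 (snd (p xs))))"
    by (simp add: weighted_sum_def S_def p_def)
  also have "\<dots> = (\<Sum>P\<in>T. \<Sum>xs\<in>{xs \<in> S. p xs = P}. q ^ list_inv xs * (g1 (fst (p xs)) * g2 (snd (p xs))))"
    by (rule sum.group[symmetric]) (use fin pS in \<open>auto simp: S_def T_def\<close>)
  also have "\<dots> = (\<Sum>(ys, zs)\<in>T. qbinom q (card A1) (card A2) *
                     (q ^ list_inv ys * g1 ys * (q ^ list_inv zs * g2 zs)))"
  proof (rule sum.cong[OF refl])
    fix P assume P: "P \<in> T"
    obtain ys zs where P': "P = (ys, zs)" by force
    from P P' have T': "set ys = A1" "set zs = A2" "distinct ys" "distinct zs"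
      by (auto simp: T_def permutations_of_set_def)
    then have len: "length ys = card A1" "length zs = card A2"
      using distinct_card by metis+
    have "(\<Sum>xs\<in>{xs \<in> S. p xs = P}. q ^ list_inv xs * (g1 (fst (p xs)) * g2 (snd (p xs)))) =
          (\<Sum>xs\<in>{xs \<in> S. p xs = (ys, zs)}. q ^ list_inv xs) * (g1 ys * g2 zs)"
      unfolding sum_distrib_right by (intro sum.cong) (auto simp: P')
    also have "\<dots> = (\<Sum>xs\<in>shuffles ys zs. q ^ list_inv xs) * (g1 ys * g2 zs)"
      using fiber P P' by simp
    also have "(\<Sum>xs\<in>shuffles ys zs. q ^ list_inv xs) =
                q ^ (list_inv ys + list_inv zs) * qbinom q (card A1) (card A2)"
      using sum_shuffles_inversions[of ys zs q] A1 A2 T' len by (metis less_trans)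
    finally show "(\<Sum>xs\<in>{xs \<in> S. p xs = P}. q ^ list_inv xs * (g1 (fst (p xs)) * g2 (snd (p xs)))) =
        (case P of (ys, zs) \<Rightarrow> qbinom q (card A1) (card A2) *
                     (q ^ list_inv ys * g1 ys * (q ^ list_inv zs * g2 zs)))"
      by (simp add: P' power_add algebra_simps)
  qed
  also have "\<dots> = qbinom q (card A1) (card A2) * (weighted_sum q A1 g1 * weighted_sum q A2 g2)"
    unfolding T_def weighted_sum_def sum_product
    by (simp add: sum_distrib_left sum.cartesian_product algebra_simps case_prod_beta)
  finally show ?thesis
    by simp
qed

lemma list_inv_Cons_perm:
  assumes "finite A" "x \<in> A" "xs \<in> permutations_of_set (A - {x})"
  shows "list_inv (x # xs) = card {y \<in> A. y < x} + list_inv xs"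
proof -
  have "distinct xs" "set xs = A - {x}"
    using assms(3) by (auto simp: permutations_of_set_def)
  then have "length (filter (\<lambda>y. y < x) xs) = card {y \<in> A - {x}. y < x}"
    by (metis distinct_length_filter Collect_conj_eq Collect_mem_eq inf_commute)
  also have "{y \<in> A - {x}. y < x} = {y \<in> A. y < x}"
    by auto
  finally show ?thesis
    by simp
qed

lemma weighted_sum_Cons:
  assumes "finite A" "A \<noteq> {}"
  shows "weighted_sum q A g =
    (\<Sum>x\<in>A. q ^ card {y \<in> A. y < x} * weighted_sum q (A - {x}) (\<lambda>xs. g (x # xs)))"
  unfolding weighted_sum_def sum_permutations_of_set_Cons[OF assms] sum_distrib_left
  by (intro sum.cong refl) (simp add: list_inv_Cons_perm[OF assms(1)] power_add del: list_inv.simps)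

text \<open>The number of smaller elements runs through \<open>0, \<dots>, card A - 1\<close> exactly once; this turns
  sums over the first entry into sums over the size of the left subtree.\<close>
lemma sum_rank:
  fixes A :: "nat set" and h :: "nat \<Rightarrow> real"
  assumes "finite A"
  shows "(\<Sum>x\<in>A. h (card {y \<in> A. y < x})) = (\<Sum>j<card A. h j)"
  using assms
proof (induction "card A" arbitrary: A)
  case 0
  then show ?case by simp
next
  case (Suc n)
  then have "A \<noteq> {}" by auto
  define M where "M = Max A"
  have M: "M \<in> A" "\<And>y. y \<in> A \<Longrightarrow> y \<le> M"
    using Suc \<open>A \<noteq> {}\<close> by (auto simp: M_def)
  define A' where "A' = A - {M}"
  have A: "A = insert M A'" "M \<notin> A'" "finite A'" "card A' = n"
    using M Suc by (auto simp: A'_def)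
  have lt: "y < M" if "y \<in> A'" for y
    using M(2)[of y] that A'_def by force
  have "{y \<in> A. y < M} = A'"
    using A lt by auto
  moreover have "{y \<in> A. y < x} = {y \<in> A'. y < x}" if "x \<in> A'" for x
    using lt[OF that] A by auto
  ultimately have "(\<Sum>x\<in>A. h (card {y \<in> A. y < x})) = h n + (\<Sum>x\<in>A'. h (card {y \<in> A'. y < x}))"
    unfolding A(1) using A by (subst sum.insert) auto
  also have "\<dots> = (\<Sum>j<card A. h j)"
    using Suc(1)[of A'] A Suc(2) by (simp flip: Suc(2))
  finally show ?case .
qed

text \<open>The \<open>q\<close>-analogue of the integer \<open>n\<close>, equal to \<open>(1 - q ^ n) / (1 - q)\<close> for \<open>q \<noteq> 1\<close>.\<close>
definition qnum :: "real \<Rightarrow> nat \<Rightarrow> real" where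
  "qnum q n = (\<Sum>i<n. q ^ i)"

lemma qnum_ge_1: "q \<ge> 0 \<Longrightarrow> n > 0 \<Longrightarrow> qnum q n \<ge> 1"
  unfolding qnum_def using member_le_sum[of 0 "{..<n}" "\<lambda>i. q ^ i"] by simp

primrec qfact :: "real \<Rightarrow> nat \<Rightarrow> real" where
  "qfact q 0 = 1"
| "qfact q (Suc n) = qnum q (Suc n) * qfact q n"

lemma qfact_pos: "q \<ge> 0 \<Longrightarrow> qfact q n > 0"
  by (induction n) (auto intro!: mult_pos_pos less_le_trans[OF zero_less_one qnum_ge_1])

lemma weighted_sum_1:
  assumes "finite A"
  shows "weighted_sum q A (\<lambda>_. 1) = qfact q (card A)"
  using assms
proof (induction "card A" arbitrary: A)
  case 0
  then show ?case by (simp add: weighted_sum_def)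
next
  case (Suc n)
  then have "A \<noteq> {}" by auto
  have "weighted_sum q A (\<lambda>_. 1) = (\<Sum>x\<in>A. q ^ card {y \<in> A. y < x} * qfact q n)"
    unfolding weighted_sum_Cons[OF \<open>finite A\<close> \<open>A \<noteq> {}\<close>]
  proof (rule sum.cong[OF refl])
    fix x assume "x \<in> A"
    then have "card (A - {x}) = n"
      using Suc by simp
    then show "q ^ card {y \<in> A. y < x} * weighted_sum q (A - {x}) (\<lambda>_. 1) =
               q ^ card {y \<in> A. y < x} * qfact q n"
      using Suc(1)[of "A - {x}"] Suc(3) by simp
  qed
  also have "\<dots> = (\<Sum>j<card A. q ^ j) * qfact q n"
    unfolding sum_rank[OF \<open>finite A\<close>, symmetric] by (simp add: sum_distrib_right)
  finally show ?case
    by (simp flip: Suc(2) add: qnum_def)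
qed

text \<open>Evaluating the total weight of all lists in two ways determines the Gaussian binomial coefficients.\<close>
lemma qbinom_qfact: "qbinom q a b * qfact q a * qfact q b = qfact q (a + b)"
proof -
  define A1 A2 where "A1 = {..<a}" and "A2 = {a<..a + b}"
  have "qfact q (a + b) = weighted_sum q (A1 \<union> A2) (\<lambda>_. 1)"
  proof -
    have "card (A1 \<union> A2) = a + b"
      by (subst card_Un_disjoint) (auto simp: A1_def A2_def)
    then show ?thesis
      by (simp add: weighted_sum_1 A1_def A2_def)
  qed
  also have "\<dots> = qbinom q a b * weighted_sum q A1 (\<lambda>_. 1) * weighted_sum q A2 (\<lambda>_. 1)"
    using weighted_sum_split[of A1 A2 a q "\<lambda>_. 1" "\<lambda>_. 1"] by (simp add: A1_def A2_def)
  finally show ?thesis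
    by (simp add: weighted_sum_1 A1_def A2_def)
qed

section \<open>The recursion for the number of levels\<close>
definition split_prob :: "real \<Rightarrow> nat \<Rightarrow> nat \<Rightarrow> real" where
  "split_prob q n j = q ^ j / qnum q n"

text \<open>\<open>height_cdf q m n\<close> is the probability that the tree of a Mallows permutation of \<open>n\<close> entries has fewer
  than \<open>m\<close> levels. The index \<open>j\<close> is the size of the left subtree. The function is
  defined by its recursion; the link to the Mallows distribution is \<open>prob_mallows_levels_less\<close>.\<close>
primrec height_cdf :: "real \<Rightarrow> nat \<Rightarrow> nat \<Rightarrow> real" where
  "height_cdf q 0 n = 0"
| "height_cdf q (Suc m) n =
     (if n = 0 then 1
      else \<Sum>j<n. split_prob q n j * height_cdf q m j * height_cdf q m (n - 1 - j))"

text \<open>Allowing every finite set in place of \<open>{1..n}\<close> lets the induction pass to the sets of smaller and of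
  larger entries without relabelling them.\<close>
lemma weighted_sum_levels_less:
  assumes "finite A" "q \<ge> 0"
  shows "weighted_sum q A (\<lambda>xs. of_bool (levels xs < m)) = qfact q (card A) * height_cdf q m (card A)"
  using assms(1)
proof (induction m arbitrary: A)
  case 0
  then show ?case by (simp add: weighted_sum_def)
next
  case (Suc m)
  show ?case
  proof (cases "A = {}")
    case True
    then show ?thesis by (simp add: weighted_sum_def)
  next
    case False
    define N where "N = card A"
    have N: "N > 0"
      using False Suc.prems by (simp add: N_def card_gt_0_iff)
    have "weighted_sum q A (\<lambda>xs. of_bool (levels xs < Suc m)) =
       (\<Sum>x\<in>A. q ^ card {y \<in> A. y < x} *
          weighted_sum q (A - {x}) (\<lambda>xs. of_bool (levels (x # xs) < Suc m)))"
      by (rule weighted_sum_Cons[OF Suc.prems False])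
    also have "\<dots> = (\<Sum>x\<in>A. (\<lambda>j. q ^ j * qfact q (N - 1) *
          (height_cdf q m j * height_cdf q m (N - 1 - j))) (card {y \<in> A. y < x}))"
    proof (rule sum.cong[OF refl])
      fix x assume x: "x \<in> A"
      define A1 A2 where "A1 = {y \<in> A. y < x}" and "A2 = {y \<in> A. y > x}"
      have U: "A - {x} = A1 \<union> A2" and fin: "finite A1" "finite A2"
        using Suc.prems by (auto simp: A1_def A2_def)
      have c: "card A1 + card A2 = N - 1"
      proof -
        have "card (A - {x}) = card A1 + card A2"
          unfolding U by (rule card_Un_disjoint) (use fin in \<open>auto simp: A1_def A2_def\<close>)
        then show ?thesis
          using x Suc.prems by (simp add: N_def)
      qed
      have "weighted_sum q (A - {x}) (\<lambda>xs. of_bool (levels (x # xs) < Suc m)) =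
            weighted_sum q (A1 \<union> A2) (\<lambda>xs. of_bool (levels (filter (\<lambda>y. y < x) xs) < m) *
               of_bool (levels (filter (\<lambda>y. y > x) xs) < m))"
        unfolding U by (rule arg_cong[of _ _ "weighted_sum q _"]) (auto simp: fun_eq_iff)
      also have "\<dots> = qbinom q (card A1) (card A2) *
            (qfact q (card A1) * height_cdf q m (card A1)) *
            (qfact q (card A2) * height_cdf q m (card A2))"
        using fin by (subst weighted_sum_split) (auto simp: A1_def A2_def Suc.IH)
      also have "\<dots> = qfact q (N - 1) * (height_cdf q m (card A1) * height_cdf q m (card A2))"
        using qbinom_qfact[of q "card A1" "card A2"] c by (simp add: algebra_simps)
      finally have W: "weighted_sum q (A - {x}) (\<lambda>xs. of_bool (levels (x # xs) < Suc m)) =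
          qfact q (N - 1) * (height_cdf q m (card A1) * height_cdf q m (card A2))" .
      then show "q ^ card {y \<in> A. y < x} *
          weighted_sum q (A - {x}) (\<lambda>xs. of_bool (levels (x # xs) < Suc m)) =
          (\<lambda>j. q ^ j * qfact q (N - 1) *
             (height_cdf q m j * height_cdf q m (N - 1 - j))) (card {y \<in> A. y < x})"
      proof -
        have "card A2 = N - 1 - card A1"
          using c by simp
        moreover have "card {y \<in> A. y < x} = card A1"
          by (simp add: A1_def)
        ultimately show ?thesis
          by (simp only: W mult.assoc)
      qed
    qed
    also have "\<dots> = (\<Sum>j<N. q ^ j * qfact q (N - 1) *
          (height_cdf q m j * height_cdf q m (N - 1 - j)))"
      unfolding N_def by (rule sum_rank[OF Suc.prems])
    also have "\<dots> = qfact q N * height_cdf q (Suc m) N"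
    proof -
      obtain k where k: "N = Suc k"
        using N by (cases N) auto
      show ?thesis
        using qnum_ge_1[OF assms(2), of N] N
        by (simp add: k sum_distrib_left split_prob_def sum_distrib_right mult_ac
            del: lessThan_Suc sum.lessThan_Suc)
    qed
    finally show ?thesis
      by (simp add: N_def)
  qed
qed

section \<open>The Mallows distribution as a weight on lists\<close>
lemma list_inv_map_upt:
  "list_inv (map \<sigma> [a..<b]) = card {(i, j). a \<le> i \<and> i < j \<and> j < b \<and> \<sigma> i > \<sigma> j}"
proof (induction "b - a" arbitrary: a)
  case 0
  then have "{(i, j). a \<le> i \<and> i < j \<and> j < b \<and> \<sigma> i > \<sigma> j} = {}" by auto
  then show ?case using 0 by (simp only: card.empty) simp
next
  case (Suc n)
  then have ab: "a < b" by simp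
  let ?P = "\<lambda>a. {(i, j). a \<le> i \<and> i < j \<and> j < b \<and> \<sigma> i > \<sigma> j}"
  have split: "?P a = Pair a ` {j \<in> {Suc a..<b}. \<sigma> j < \<sigma> a} \<union> ?P (Suc a)"
    by (auto simp: Suc_le_eq le_less)
  have "finite (?P (Suc a))"
    by (rule finite_subset[of _ "{..<b} \<times> {..<b}"]) auto
  then have "card (?P a) = card {j \<in> {Suc a..<b}. \<sigma> j < \<sigma> a} + card (?P (Suc a))"
    unfolding split by (subst card_Un_disjoint) (auto simp: card_image inj_on_def)
  moreover have "length (filter (\<lambda>y. y < \<sigma> a) (map \<sigma> [Suc a..<b])) =
                 card {j \<in> {Suc a..<b}. \<sigma> j < \<sigma> a}"
    by (simp add: filter_map distinct_length_filter o_def Int_def conj_commute)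
  ultimately show ?case
    using Suc(1)[of "Suc a"] Suc(2) by (simp add: upt_conv_Cons[OF ab])
qed

lemma Inv_eq_list_inv: "Inv n \<sigma> = list_inv (map \<sigma> [1..<Suc n])"
  unfolding Inv_def list_inv_map_upt by (rule arg_cong[of _ _ card]) auto

lemma bij_betw_permutes_permutations_of_set:
  "bij_betw (\<lambda>\<sigma>. map \<sigma> [1..<Suc n]) {\<sigma>. \<sigma> permutes {1..n}} (permutations_of_set {1..n})"
proof -
  have inj: "inj_on (\<lambda>\<sigma>. map \<sigma> [1..<Suc n]) {\<sigma>. \<sigma> permutes {1..n}}"
  proof (intro inj_onI ext)
    fix \<sigma> \<tau> x
    assume *: "\<sigma> \<in> {\<sigma>. \<sigma> permutes {1..n}}" "\<tau> \<in> {\<sigma>. \<sigma> permutes {1..n}}"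
      "map \<sigma> [1..<Suc n] = map \<tau> [1..<Suc n]"
    show "\<sigma> x = \<tau> x"
    proof (cases "x \<in> {1..n}")
      case True
      then have "x \<in> set [1..<Suc n]"
        by auto
      with *(3) show ?thesis
        unfolding map_eq_conv by blast
    next
      case False
      with * show ?thesis
        by (auto simp: permutes_not_in)
    qed
  qed
  have sub: "(\<lambda>\<sigma>. map \<sigma> [1..<Suc n]) ` {\<sigma>. \<sigma> permutes {1..n}} \<subseteq> permutations_of_set {1..n}"
  proof clarify
    fix \<sigma> assume p: "\<sigma> permutes {1..n}"
    have s: "set [1..<Suc n] = {1..n}" by auto
    have "inj_on \<sigma> {1..n}"
      using p by (metis permutes_inj inj_on_subset subset_UNIV)
    then have "distinct (map \<sigma> [1..<Suc n])"
      unfolding distinct_map s by simp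
    moreover have "set (map \<sigma> [1..<Suc n]) = {1..n}"
      unfolding set_map s using permutes_image[OF p] .
    ultimately show "map \<sigma> [1..<Suc n] \<in> permutations_of_set {1..n}"
      by (simp add: permutations_of_set_def)
  qed
  have "card {\<sigma>. \<sigma> permutes {1..n}} = card (permutations_of_set {1..n})"
    by (subst card_permutations[of _ n]) simp_all
  then have "card ((\<lambda>\<sigma>. map \<sigma> [1..<Suc n]) ` {\<sigma>. \<sigma> permutes {1..n}}) = card (permutations_of_set {1..n})"
    unfolding card_image[OF inj] .
  then have "(\<lambda>\<sigma>. map \<sigma> [1..<Suc n]) ` {\<sigma>. \<sigma> permutes {1..n}} = permutations_of_set {1..n}"
    by (intro card_subset_eq sub) simp_all
  with inj show ?thesis
    by (rule bij_betw_imageI)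
qed

lemma sum_permutes_weighted_sum:
  "(\<Sum>\<sigma> | \<sigma> permutes {1..n}. q ^ Inv n \<sigma> * g (map \<sigma> [1..<Suc n])) = weighted_sum q {1..n} g"
  unfolding weighted_sum_def Inv_eq_list_inv
  by (rule sum.reindex_bij_betw[OF bij_betw_permutes_permutations_of_set])

lemma prob_mallows_levels_less:
  assumes "q \<ge> 0"
  shows "measure_pmf.prob (mallows n q) {\<sigma>. levels (map \<sigma> [1..<Suc n]) < m} = height_cdf q m n"
proof -
  let ?S = "{\<sigma>. \<sigma> permutes {1..n}}" and ?E = "{\<sigma>. levels (map \<sigma> [1..<Suc n]) < m}"
  have fin: "finite ?S" by (simp add: finite_permutations)
  have set: "set_pmf (mallows n q) \<subseteq> ?S"
    by (auto simp: set_pmf_eq pmf_mallows[OF assms] split: if_splits)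
  have Z: "mallows_Z n q = qfact q n"
    using sum_permutes_weighted_sum[where q=q and g="\<lambda>_. 1" and n=n] weighted_sum_1[of "{1..n}" q]
    by (simp add: mallows_Z_def)
  have "measure_pmf.prob (mallows n q) ?E = measure_pmf.prob (mallows n q) (?E \<inter> ?S)"
    using set by (intro measure_prob_cong_0) (auto simp: set_pmf_eq)
  also have "\<dots> = (\<Sum>\<sigma>\<in>?E \<inter> ?S. pmf (mallows n q) \<sigma>)"
    by (rule measure_measure_pmf_finite) (use fin in auto)
  also have "\<dots> = (\<Sum>\<sigma>\<in>?S. pmf (mallows n q) \<sigma> * of_bool (levels (map \<sigma> [1..<Suc n]) < m))"
    using fin by (intro sum.mono_neutral_cong_left) auto
  also have "\<dots> = (\<Sum>\<sigma>\<in>?S. q ^ Inv n \<sigma> * of_bool (levels (map \<sigma> [1..<Suc n]) < m)) / mallows_Z n q"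
    unfolding sum_divide_distrib by (intro sum.cong refl) (simp add: pmf_mallows[OF assms])
  also have "\<dots> = weighted_sum q {1..n} (\<lambda>xs. of_bool (levels xs < m)) / mallows_Z n q"
    by (simp only: sum_permutes_weighted_sum[where q=q and g="\<lambda>xs. of_bool (levels xs < m)" and n=n])
  also have "\<dots> = height_cdf q m n"
    using qfact_pos[OF assms, of n] by (subst weighted_sum_levels_less) (use assms in \<open>auto simp: Z\<close>)
  finally show ?thesis .
qed

section \<open>Elementary properties of the recursion\<close>
lemma qnum_Suc: "qnum q (Suc n) = qnum q n + q ^ n"
  by (simp add: qnum_def)

lemma qnum_geometric: "(1 - q) * qnum q n = 1 - q ^ n"
  by (simp add: qnum_def one_diff_power_eq)

lemma qnum_pos: "q \<ge> 0 \<Longrightarrow> n > 0 \<Longrightarrow> qnum q n > 0"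
  using qnum_ge_1[of q n] by linarith

lemma qnum_nonneg: "q \<ge> 0 \<Longrightarrow> qnum q n \<ge> 0"
  by (simp add: qnum_def sum_nonneg)

lemma qnum_mono: "q \<ge> 0 \<Longrightarrow> m \<le> n \<Longrightarrow> qnum q m \<le> qnum q n"
  unfolding qnum_def by (rule sum_mono2) auto

lemma qnum_lower: "0 \<le> q \<Longrightarrow> q \<le> 1 \<Longrightarrow> real n * q ^ n \<le> qnum q n"
  using sum_mono[of "{..<n}" "\<lambda>_. q ^ n" "\<lambda>i. q ^ i"]
  by (simp add: qnum_def power_decreasing)

text \<open>Rearranged, \<open>1 / qnum q n \<le> 1 / n + (1 - q)\<close>: the largest splitting probability is at most the uniform
  one plus the untruncated geometric one.\<close>
lemma le_qnum_times:
  assumes "0 \<le> q" "q \<le> 1"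
  shows "real n \<le> (1 + real n * (1 - q)) * qnum q n"
proof -
  have "(1 + real n * (1 - q)) * qnum q n = qnum q n + real n * (1 - q ^ n)"
    by (simp add: algebra_simps flip: qnum_geometric)
  then show ?thesis
    using qnum_lower[OF assms, of n] by (simp add: algebra_simps)
qed

lemma split_prob_nonneg: "q \<ge> 0 \<Longrightarrow> split_prob q n j \<ge> 0"
  by (simp add: split_prob_def qnum_nonneg)

lemma sum_split_prob: "q \<ge> 0 \<Longrightarrow> n > 0 \<Longrightarrow> (\<Sum>j<n. split_prob q n j) = 1"
  using qnum_pos[of q n] by (simp add: split_prob_def qnum_def flip: sum_divide_distrib)

lemma height_cdf_bounds:
  assumes "q \<ge> 0"
  shows "height_cdf q m n \<in> {0..1}"
proof (induction m arbitrary: n)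
  case (Suc m)
  show ?case
  proof (cases "n = 0")
    case False
    have "(\<Sum>j<n. split_prob q n j * height_cdf q m j * height_cdf q m (n - 1 - j)) \<le>
          (\<Sum>j<n. split_prob q n j * 1 * 1)"
      using Suc split_prob_nonneg[OF assms] by (intro sum_mono mult_mono) auto
    moreover have "(\<Sum>j<n. split_prob q n j * height_cdf q m j * height_cdf q m (n - 1 - j)) \<ge> 0"
      using Suc split_prob_nonneg[OF assms] by (intro sum_nonneg mult_nonneg_nonneg) auto
    ultimately show ?thesis
      using sum_split_prob[OF assms, of n] False by simp
  qed simp
qed simp

lemma height_cdf_nonneg: "q \<ge> 0 \<Longrightarrow> height_cdf q m n \<ge> 0"
  and height_cdf_le_1: "q \<ge> 0 \<Longrightarrow> height_cdf q m n \<le> 1"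
  using height_cdf_bounds[of q m n] by auto

lemma height_cdf_Suc_ge:
  assumes "q \<ge> 0"
  shows "height_cdf q m n \<le> height_cdf q (Suc m) n"
proof (induction m arbitrary: n)
  case 0
  show ?case
    using height_cdf_nonneg[OF assms, of "Suc 0" n] by simp
next
  case (Suc m)
  show ?case
  proof (cases "n = 0")
    case False
    have "split_prob q n j * height_cdf q m j * height_cdf q m (n - 1 - j)
        \<le> split_prob q n j * height_cdf q (Suc m) j * height_cdf q (Suc m) (n - 1 - j)" for j
      by (intro mult_mono mult_nonneg_nonneg order_refl Suc split_prob_nonneg[OF assms]
          height_cdf_nonneg[OF assms])
    then show ?thesis
      using False by (subst (1 2) height_cdf.simps(2)) (simp add: sum_mono del: height_cdf.simps)
  qed simp
qed

lemma height_cdf_mono: "q \<ge> 0 \<Longrightarrow> m \<le> m' \<Longrightarrow> height_cdf q m n \<le> height_cdf q m' n"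
  by (rule lift_Suc_mono_le[of "\<lambda>m. height_cdf q m n"]) (simp_all add: height_cdf_Suc_ge del: height_cdf.simps)

definition height_tail :: "real \<Rightarrow> nat \<Rightarrow> nat \<Rightarrow> real" where
  "height_tail q m n = 1 - height_cdf q m n"

lemma height_tail_nonneg: "q \<ge> 0 \<Longrightarrow> height_tail q m n \<ge> 0"
  and height_tail_le_1: "q \<ge> 0 \<Longrightarrow> height_tail q m n \<le> 1"
  using height_cdf_bounds[of q m n] by (auto simp: height_tail_def)

lemma height_tail_antimono: "q \<ge> 0 \<Longrightarrow> m \<le> m' \<Longrightarrow> height_tail q m' n \<le> height_tail q m n"
  using height_cdf_mono by (simp add: height_tail_def)

lemma height_tail_Suc:
  assumes "q \<ge> 0" "n > 0"
  shows "height_tail q (Suc m) n =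
    (\<Sum>j<n. split_prob q n j *
       (1 - (1 - height_tail q m j) * (1 - height_tail q m (n - 1 - j))))"
  using sum_split_prob[OF assms] assms(2)
  by (simp add: height_tail_def right_diff_distrib sum_subtractf mult.assoc)

text \<open>A union bound over the two subtrees: the recursion is dominated by a linear one.\<close>
lemma height_tail_Suc_le:
  assumes "q \<ge> 0" "n > 0"
  shows "height_tail q (Suc m) n \<le>
    (\<Sum>j<n. split_prob q n j * height_tail q m j) + (\<Sum>j<n. split_prob q n j * height_tail q m (n - 1 - j))"
  unfolding height_tail_Suc[OF assms] sum.distrib[symmetric] distrib_left[symmetric]
  using split_prob_nonneg[OF assms(1)] height_tail_nonneg[OF assms(1)]
  by (intro sum_mono mult_left_mono) (auto simp: algebra_simps)

lemma height_tail_Suc_0: "height_tail q (Suc m) 0 = 0"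
  by (simp add: height_tail_def)

section \<open>An exponential potential for the upper bound\<close>

text \<open>The discrete counterpart of the integral of \<open>x powr \<alpha>\<close>, by the mean value theorem.\<close>
lemma sum_powr_le:
  fixes \<alpha> :: real
  assumes "\<alpha> > 0"
  shows "(\<Sum>j<n. real j powr \<alpha>) \<le> real n powr (\<alpha> + 1) / (\<alpha> + 1)"
proof (induction n)
  case (Suc n)
  have "real n powr (\<alpha> + 1) + (\<alpha> + 1) * real n powr \<alpha> \<le> real (Suc n) powr (\<alpha> + 1)"
  proof (cases "n = 0")
    case False
    have "\<exists>z. real n < z \<and> z < real (Suc n) \<and>
       real (Suc n) powr (\<alpha> + 1) - real n powr (\<alpha> + 1) = (real (Suc n) - real n) * ((\<alpha> + 1) * z powr \<alpha>)"
    proof (rule MVT2)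
      fix x :: real assume "real n \<le> x"
      then have "x > 0"
        using False by simp
      then show "((\<lambda>x. x powr (\<alpha> + 1)) has_real_derivative (\<alpha> + 1) * x powr \<alpha>) (at x)"
        using has_real_derivative_powr[of x "\<alpha> + 1"] by simp
    qed simp
    then obtain z where z: "real n < z"
      "real (Suc n) powr (\<alpha> + 1) - real n powr (\<alpha> + 1) = (\<alpha> + 1) * z powr \<alpha>"
      by auto
    have "real n powr \<alpha> \<le> z powr \<alpha>"
      using z assms by (intro powr_mono2) auto
    then have "(\<alpha> + 1) * real n powr \<alpha> \<le> (\<alpha> + 1) * z powr \<alpha>"
      using assms by (intro mult_left_mono) auto
    with z show ?thesis by linarith
  qed auto
  then have "real n powr (\<alpha> + 1) / (\<alpha> + 1) + real n powr \<alpha> \<le> real (Suc n) powr (\<alpha> + 1) / (\<alpha> + 1)"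
    using assms divide_right_mono[of _ _ "\<alpha> + 1"] by (fastforce simp: add_divide_distrib)
  with Suc show ?case
    by simp
qed simp

lemma sum_reflect: "(\<Sum>j<n. f (n - 1 - j)) = (\<Sum>j<n. f j)" for f :: "nat \<Rightarrow> real"
  using sum.nat_diff_reindex[of f n] by simp

lemma sum_geometric_le:
  fixes q a :: real
  assumes "q \<ge> 0" "a > q"
  shows "(\<Sum>j<n. q ^ j * a ^ (n - 1 - j)) \<le> a ^ n / (a - q)"
proof -
  have "(a - q) * (\<Sum>j<n. q ^ j * a ^ (n - 1 - j)) = a ^ n - q ^ n"
    using power_diff_sumr2[of q n a] by (simp add: algebra_simps)
  also have "\<dots> \<le> a ^ n"
    using assms by simp
  finally show ?thesis
    using assms by (simp add: field_simps)
qed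

text \<open>The potential \<open>n powr \<alpha> * A ^ n\<close> combines two regimes. For an almost uniform split, \<open>n powr \<alpha>\<close> alone
  loses a factor \<open>1 / (\<alpha> + 1)\<close> in expectation on each side. When \<open>n (1 - q)\<close> is not small, the right
  subtree keeps almost all entries, and the factor must come from \<open>A ^ n\<close>: a geometric number of removed
  entries reduces it by \<open>1 / (1 + \<gamma>)\<close>. The value of \<open>\<gamma>\<close> makes this second gain at least as good as
  the first one, also after the loss \<open>1 + 1 / \<delta>\<close> from truncating the geometric distribution.\<close>
context
  fixes q \<alpha> \<delta> \<gamma> A :: real
  assumes q: "0 \<le> q" "q \<le> 1" and \<alpha>: "\<alpha> > 0" and \<delta>: "\<delta> > 0"
    and \<gamma>: "\<gamma> = 2 * (\<alpha> + 1) * (1 + 1 / \<delta>)" and A: "A = 1 + \<gamma> * (1 - q)"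
begin

lemma potential_rate_ge: "\<gamma> \<ge> 2 * (\<alpha> + 1)" "1 + \<gamma> \<ge> (\<alpha> + 1) * (1 + 1 / \<delta>)"
proof -
  have "2 * (\<alpha> + 1) * 1 \<le> 2 * (\<alpha> + 1) * (1 + 1 / \<delta>)"
    using \<alpha> \<delta> by (intro mult_left_mono) auto
  then show "\<gamma> \<ge> 2 * (\<alpha> + 1)"
    by (simp add: \<gamma>)
  define x where "x = (\<alpha> + 1) * (1 + 1 / \<delta>)"
  have "\<gamma> = 2 * x" "x \<ge> 0"
    using \<alpha> \<delta> by (simp_all add: \<gamma> x_def)
  then have "1 + \<gamma> \<ge> x"
    by linarith
  then show "1 + \<gamma> \<ge> (\<alpha> + 1) * (1 + 1 / \<delta>)"
    by (simp add: x_def)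
qed

lemma potential_base_ge_1: "A \<ge> 1"
  using potential_rate_ge(1) \<alpha> q by (simp add: A)

lemma sum_powr_div_le:
  assumes n: "n > 0" shows "(\<Sum>j<n. real j powr \<alpha>) / real n \<le> real n powr \<alpha> / (\<alpha> + 1)"
  using sum_powr_le[OF \<alpha>, of n] n \<alpha> by (simp add: powr_add field_simps)

text \<open>If \<open>A q \<ge> 1\<close>, the factor \<open>A ^ j\<close> outweighs the decay of \<open>q ^ j\<close>, and the weighted splitting
  probabilities are at most the uniform ones. Otherwise \<open>q \<le> 1 / 2\<close>, and \<open>A\<close> is so
  large that losing a single entry suffices.\<close>
lemma left_subtree_potential:
  assumes n: "n > 0"
  shows "(\<Sum>j<n. split_prob q n j * (real j powr \<alpha> * A ^ j)) \<le> real n powr \<alpha> * A ^ n / (\<alpha> + 1)"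
proof (cases "A * q \<ge> 1")
  case True
  have "split_prob q n j * A ^ j \<le> A ^ n / real n" if "j < n" for j
  proof -
    have "1 * (q ^ j * A ^ j) \<le> (A * q) ^ (n - j) * (q ^ j * A ^ j)"
      using True q potential_base_ge_1 by (intro mult_right_mono one_le_power) auto
    also have "\<dots> = A ^ n * q ^ n"
      using that by (simp add: power_mult_distrib mult_ac flip: power_add)
    finally have "real n * (q ^ j * A ^ j) \<le> A ^ n * (real n * q ^ n)"
      by (simp add: mult_left_mono algebra_simps)
    also have "\<dots> \<le> A ^ n * qnum q n"
      using qnum_lower[OF q] potential_base_ge_1 by (intro mult_left_mono) auto
    finally show ?thesis
      using qnum_pos[OF q(1) n] n by (simp add: split_prob_def field_simps)
  qed
  then have "(\<Sum>j<n. (split_prob q n j * A ^ j) * real j powr \<alpha>) \<le> (\<Sum>j<n. (A ^ n / real n) * real j powr \<alpha>)"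
    by (intro sum_mono mult_right_mono) auto
  also have "\<dots> = A ^ n * ((\<Sum>j<n. real j powr \<alpha>) / real n)"
    by (simp add: sum_distrib_left sum_divide_distrib)
  also have "\<dots> \<le> A ^ n * (real n powr \<alpha> / (\<alpha> + 1))"
    using sum_powr_div_le[OF n] potential_base_ge_1 by (intro mult_left_mono) auto
  finally show ?thesis
    by (simp add: mult_ac)
next
  case False
  have "q \<le> 1 / 2"
  proof (rule ccontr)
    assume "\<not> q \<le> 1 / 2"
    then have "q * 2 * (1 - q) \<le> q * \<gamma> * (1 - q)" "1 * (1 - q) \<le> q * 2 * (1 - q)"
      using potential_rate_ge \<alpha> q by (intro mult_right_mono mult_left_mono; simp)+
    with False show False
      by (simp add: A algebra_simps)
  qed
  then have "\<gamma> * (1 / 2) \<le> \<gamma> * (1 - q)"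
    using potential_rate_ge \<alpha> by (intro mult_left_mono) auto
  then have A_ge: "\<alpha> + 1 \<le> A"
    using potential_rate_ge by (simp add: A)
  have "A ^ j * (\<alpha> + 1) \<le> A ^ n" if "j < n" for j
  proof -
    have "A ^ j * (\<alpha> + 1) \<le> A ^ j * A"
      using A_ge potential_base_ge_1 by (intro mult_left_mono) auto
    also have "\<dots> = A ^ Suc j" by simp
    also have "\<dots> \<le> A ^ n"
      using that potential_base_ge_1 by (intro power_increasing) auto
    finally show ?thesis .
  qed
  then have "real j powr \<alpha> * A ^ j \<le> real n powr \<alpha> * (A ^ n / (\<alpha> + 1))" if "j < n" for j
    using that \<alpha> potential_base_ge_1 by (intro mult_mono powr_mono2) (auto simp: field_simps)
  then have "(\<Sum>j<n. split_prob q n j * (real j powr \<alpha> * A ^ j)) \<le>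
      (\<Sum>j<n. split_prob q n j * (real n powr \<alpha> * (A ^ n / (\<alpha> + 1))))"
    using split_prob_nonneg[OF q(1)] by (intro sum_mono mult_left_mono) auto
  also have "\<dots> = real n powr \<alpha> * (A ^ n / (\<alpha> + 1))"
    unfolding sum_distrib_right[symmetric] using sum_split_prob[OF q(1) n] by simp
  finally show ?thesis by simp
qed

text \<open>For \<open>n (1 - q) \<le> \<delta>\<close> the splitting probabilities are at most \<open>(1 + \<delta>) / n\<close>, and the gain comes from the
  power of \<open>n\<close>; otherwise it comes from the geometric sum.\<close>
lemma right_subtree_potential:
  assumes n: "n > 0"
  shows "(\<Sum>j<n. split_prob q n j * (real (n - 1 - j) powr \<alpha> * A ^ (n - 1 - j)))
           \<le> (1 + \<delta>) * (real n powr \<alpha> * A ^ n / (\<alpha> + 1))"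
proof (cases "real n * (1 - q) \<le> \<delta>")
  case True
  have "split_prob q n j * A ^ (n - 1 - j) \<le> (1 + \<delta>) * A ^ n / real n" for j
  proof -
    have "real n \<le> (1 + \<delta>) * qnum q n"
      using le_qnum_times[OF q, of n] mult_right_mono[of "1 + real n * (1 - q)" "1 + \<delta>" "qnum q n"]
        True qnum_nonneg[OF q(1)] by simp
    then have "1 / qnum q n \<le> (1 + \<delta>) / real n"
      using qnum_pos[OF q(1) n] n by (simp add: field_simps)
    moreover have "q ^ j * A ^ (n - 1 - j) \<le> 1 * A ^ n"
      using q potential_base_ge_1 by (intro mult_mono power_le_one power_increasing) auto
    ultimately have "(q ^ j * A ^ (n - 1 - j)) * (1 / qnum q n) \<le> A ^ n * ((1 + \<delta>) / real n)"
      using q potential_base_ge_1 \<delta> qnum_nonneg[OF q(1)] by (intro mult_mono) auto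
    then show ?thesis by (simp add: split_prob_def mult_ac)
  qed
  then have "(\<Sum>j<n. (split_prob q n j * A ^ (n - 1 - j)) * real (n - 1 - j) powr \<alpha>) \<le>
        (\<Sum>j<n. ((1 + \<delta>) * A ^ n / real n) * real (n - 1 - j) powr \<alpha>)"
    by (intro sum_mono mult_right_mono) auto
  also have "\<dots> = (1 + \<delta>) * A ^ n * ((\<Sum>j<n. real j powr \<alpha>) / real n)"
    unfolding sum_distrib_left[symmetric] sum_reflect[of "\<lambda>j. real j powr \<alpha>"] by simp
  also have "\<dots> \<le> (1 + \<delta>) * A ^ n * (real n powr \<alpha> / (\<alpha> + 1))"
    using sum_powr_div_le[OF n] potential_base_ge_1 \<delta> by (intro mult_left_mono) auto
  finally show ?thesis
    by (simp add: mult_ac)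
next
  case False
  have t: "1 - q > 0"
    using False \<delta> q by (cases "q = 1") auto
  have Aq: "A - q = (1 + \<gamma>) * (1 - q)"
    by (simp add: A algebra_simps)
  have g: "1 + \<gamma> > 0"
    using less_le_trans[OF _ potential_rate_ge(1), of 0] \<alpha> by simp
  have pos: "A - q > 0"
    unfolding Aq using t g by simp
  have "1 / qnum q n \<le> (1 + real n * (1 - q)) / real n"
    using le_qnum_times[OF q, of n] qnum_pos[OF q(1) n] n by (simp add: field_simps)
  also have "\<dots> = 1 / real n + (1 - q)"
    using n by (simp add: field_simps)
  also have "\<dots> \<le> (1 - q) * (1 + 1 / \<delta>)"
    using False n \<delta> by (simp add: field_simps)
  finally have inv: "1 / qnum q n \<le> (1 - q) * (1 + 1 / \<delta>)" .
  have "(\<Sum>j<n. split_prob q n j * (real (n - 1 - j) powr \<alpha> * A ^ (n - 1 - j))) \<le>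
        (\<Sum>j<n. split_prob q n j * (real n powr \<alpha> * A ^ (n - 1 - j)))"
    using split_prob_nonneg[OF q(1)] \<alpha> potential_base_ge_1
    by (intro sum_mono mult_left_mono mult_right_mono powr_mono2) auto
  also have "\<dots> = real n powr \<alpha> * (\<Sum>j<n. q ^ j * A ^ (n - 1 - j)) * (1 / qnum q n)"
    by (simp add: split_prob_def sum_distrib_left sum_divide_distrib mult_ac)
  also have "\<dots> \<le> real n powr \<alpha> * (A ^ n / (A - q)) * ((1 - q) * (1 + 1 / \<delta>))"
    using sum_geometric_le[of q A n] pos inv qnum_nonneg[OF q(1)] q potential_base_ge_1
    by (intro mult_mono mult_left_mono mult_nonneg_nonneg) auto
  also have "\<dots> = real n powr \<alpha> * A ^ n * ((1 + 1 / \<delta>) / (1 + \<gamma>))"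
    unfolding Aq using t by simp
  also have "\<dots> \<le> real n powr \<alpha> * A ^ n * (1 / (\<alpha> + 1))"
    using potential_rate_ge(2) g \<alpha> potential_base_ge_1 by (intro mult_left_mono) (auto simp: divide_simps mult.commute)
  also have "\<dots> = 1 * (real n powr \<alpha> * A ^ n / (\<alpha> + 1))"
    by simp
  also have "\<dots> \<le> (1 + \<delta>) * (real n powr \<alpha> * A ^ n / (\<alpha> + 1))"
    using \<delta> \<alpha> potential_base_ge_1 by (intro mult_right_mono) auto
  finally show ?thesis .
qed

text \<open>The first moment bound: both sides contribute a factor \<open>(1 + \<delta>) / (\<alpha> + 1)\<close> per level. The index
  starts at \<open>Suc m\<close> since the empty tree, at which the potential vanishes, does have at least \<open>0\<close> levels.\<close>
lemma height_tail_potential: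
  "height_tail q (Suc m) n \<le> (2 * (1 + \<delta>) / (\<alpha> + 1)) ^ m * (real n powr \<alpha> * A ^ n)"
proof (induction m arbitrary: n)
  case 0
  show ?case
  proof (cases "n = 0")
    case False
    have "1 * 1 \<le> real n powr \<alpha> * A ^ n"
      using False \<alpha> potential_base_ge_1 by (intro mult_mono ge_one_powr_ge_zero one_le_power) auto
    then show ?thesis
      using height_tail_le_1[OF q(1), of "Suc 0" n] by simp
  qed (simp add: height_tail_Suc_0)
next
  case (Suc m)
  define b where "b = 2 * (1 + \<delta>) / (\<alpha> + 1)"
  have b: "b \<ge> 0"
    using \<alpha> \<delta> by (simp add: b_def)
  define \<phi> where "\<phi> = (\<lambda>n. real n powr \<alpha> * A ^ n)"
  have IH: "height_tail q (Suc m) k \<le> b ^ m * \<phi> k" for k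
    using Suc.IH[of k] by (simp add: b_def \<phi>_def)
  show ?case
  proof (cases "n = 0")
    case False
    then have n: "n > 0" by simp
    have "height_tail q (Suc (Suc m)) n \<le>
       (\<Sum>j<n. split_prob q n j * height_tail q (Suc m) j) +
       (\<Sum>j<n. split_prob q n j * height_tail q (Suc m) (n - 1 - j))"
      by (rule height_tail_Suc_le[OF q(1) n])
    also have "\<dots> \<le> (\<Sum>j<n. split_prob q n j * (b ^ m * \<phi> j)) +
       (\<Sum>j<n. split_prob q n j * (b ^ m * \<phi> (n - 1 - j)))"
      by (intro add_mono sum_mono mult_left_mono IH split_prob_nonneg q)
    also have "\<dots> = b ^ m * ((\<Sum>j<n. split_prob q n j * \<phi> j) + (\<Sum>j<n. split_prob q n j * \<phi> (n - 1 - j)))"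
      by (simp add: sum_distrib_left algebra_simps)
    also have "\<dots> \<le> b ^ m * (1 * (\<phi> n / (\<alpha> + 1)) + (1 + \<delta>) * (\<phi> n / (\<alpha> + 1)))"
      using left_subtree_potential[OF n] right_subtree_potential[OF n] b
      by (intro mult_left_mono add_mono) (auto simp: \<phi>_def)
    also have "\<dots> \<le> b ^ m * ((1 + \<delta>) * (\<phi> n / (\<alpha> + 1)) + (1 + \<delta>) * (\<phi> n / (\<alpha> + 1)))"
      using b \<delta> \<alpha> potential_base_ge_1 by (intro mult_left_mono add_mono mult_right_mono) (auto simp: \<phi>_def)
    also have "\<dots> = b ^ Suc m * \<phi> n"
      by (simp add: b_def field_simps)
    finally show ?thesis
      by (simp add: b_def \<phi>_def)
  qed (simp add: height_tail_Suc_0)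
qed

end

section \<open>Moving along the right spine\<close>
lemma power_le_exp:
  assumes "q \<ge> (0::real)"
  shows "q ^ k \<le> exp (- (real k * (1 - q)))"
proof -
  have "q \<le> exp (q - 1)"
    using exp_ge_add_one_self[of "q - 1"] by simp
  then have "q ^ k \<le> exp (q - 1) ^ k"
    using assms by (intro power_mono) auto
  also have "\<dots> = exp (- (real k * (1 - q)))"
    by (simp add: algebra_simps flip: exp_of_nat_mult)
  finally show ?thesis .
qed

lemma sum_split_prob_tail:
  assumes q: "0 \<le> q" "q \<le> 1" and n: "n > 0"
  shows "(\<Sum>j | j < n \<and> \<xi> < real j * (1 - q). split_prob q n j) \<le> exp (- \<xi>)"
proof (cases "{j. j < n \<and> \<xi> < real j * (1 - q)} = {}")
  case False
  define k where "k = (LEAST j. \<xi> < real j * (1 - q))"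
  from False obtain j where j: "j < n" "\<xi> < real j * (1 - q)" by auto
  have k: "\<xi> < real k * (1 - q)" "k < n"
    using LeastI[of "\<lambda>j. \<xi> < real j * (1 - q)" j] Least_le[of "\<lambda>j. \<xi> < real j * (1 - q)" j] j
    by (auto simp: k_def)
  have "(\<Sum>j | j < n \<and> \<xi> < real j * (1 - q). split_prob q n j) \<le> (\<Sum>j\<in>{k..<n}. split_prob q n j)"
    using split_prob_nonneg[OF q(1)] by (intro sum_mono2) (auto simp: k_def Least_le)
  also have "\<dots> = (\<Sum>j<n - k. q ^ (j + k)) / qnum q n"
    unfolding split_prob_def sum_divide_distrib[symmetric]
    using sum.shift_bounds_nat_ivl[of "\<lambda>j. q ^ j" 0 k "n - k"] k by (simp add: lessThan_atLeast0)
  also have "\<dots> = q ^ k * (qnum q (n - k) / qnum q n)"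
    by (simp add: qnum_def power_add sum_distrib_left mult.commute)
  also have "\<dots> \<le> exp (- \<xi>) * 1"
  proof (intro mult_mono)
    show "q ^ k \<le> exp (- \<xi>)"
      by (rule order_trans[OF power_le_exp[OF q(1)]]) (use k(1) in simp)
    show "qnum q (n - k) / qnum q n \<le> 1"
      using qnum_mono[OF q(1), of "n - k" n] qnum_pos[OF q(1) n] by simp
  qed (use qnum_nonneg[OF q(1)] in auto)
  finally show ?thesis by simp
next
  case True
  then show ?thesis by (simp only: sum.empty exp_ge_zero)
qed

text \<open>Explore the right spine until the remaining tree is small, in the sense that
  \<open>k (1 - q) \<le> \<xi>\<close>. At each of at most \<open>r + 1\<close> stages, a small tree is
  too high with probability at most \<open>g\<close>, and a left subtree is not small with probability at most
  \<open>exp (- \<xi>)\<close>. The last summand is a Chernoff bound for the event that \<open>r\<close> steps do not reach a small tree: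
  \<open>(1 + \<theta> (1 - q)) ^ k\<close> decreases on average by the factor
  \<open>(1 + \<theta>) (1 - exp (- \<xi>))\<close> per step as long as \<open>k\<close> is not small.\<close>
lemma spine_upper:
  fixes q \<xi> \<theta> g :: real
  assumes q: "0 \<le> q" "q \<le> 1" and \<xi>: "\<xi> > 0" and \<theta>: "\<theta> > 0" and g: "g \<ge> 0"
    and small: "\<And>k. k \<le> n \<Longrightarrow> real k * (1 - q) \<le> \<xi> \<Longrightarrow> height_tail q m k \<le> g"
    and kn: "k \<le> n"
  shows "height_tail q (m + r) k \<le> (real r + 1) * (g + exp (- \<xi>)) +
           (1 + \<theta> * (1 - q)) ^ k / ((1 + \<theta>) * (1 - exp (- \<xi>))) ^ r"
proof -
  define a where "a = 1 + \<theta> * (1 - q)"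
  define b where "b = (1 + \<theta>) * (1 - exp (- \<xi>))"
  define e where "e = g + exp (- \<xi>)"
  have a: "a \<ge> 1" using \<theta> q by (simp add: a_def)
  have b: "b > 0" using \<xi> \<theta> by (simp add: b_def)
  have e: "e \<ge> 0" "g \<le> e" using g by (simp_all add: e_def)
  have "height_tail q (m + r) k \<le> (real r + 1) * e + a ^ k / b ^ r"
    using kn
  proof (induction r arbitrary: k)
    case 0
    have "1 \<le> a ^ k" using a by simp
    then show ?case
      using height_tail_le_1[OF q(1), of m k] e by simp
  next
    case (Suc r)
    show ?case
    proof (cases "real k * (1 - q) \<le> \<xi>")
      case True
      have "height_tail q (m + Suc r) k \<le> height_tail q m k"
        by (rule height_tail_antimono[OF q(1)]) simp
      also have "\<dots> \<le> 1 * e"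
        using small[OF Suc.prems True] e by simp
      also have "\<dots> \<le> (real (Suc r) + 1) * e"
        using e by (intro mult_right_mono) auto
      also have "\<dots> \<le> (real (Suc r) + 1) * e + a ^ k / b ^ Suc r"
        using a b by simp
      finally show ?thesis .
    next
      case False
      then have k: "k > 0" using \<xi> by (cases k) auto
      have t: "1 - q > 0" using False \<xi> q by (cases "q = 1") auto
      have left: "(\<Sum>j<k. split_prob q k j * height_tail q (m + r) j) \<le> e"
      proof -
        have "height_tail q (m + r) j \<le> g + of_bool (\<xi> < real j * (1 - q))" if "j < k" for j
          using height_tail_le_1[OF q(1), of "m + r" j] small[of j] that Suc.prems g
            height_tail_antimono[OF q(1), of m "m + r" j] by (cases "\<xi> < real j * (1 - q)") auto
        then have "(\<Sum>j<k. split_prob q k j * height_tail q (m + r) j) \<le>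
              (\<Sum>j<k. split_prob q k j * (g + of_bool (\<xi> < real j * (1 - q))))"
          using split_prob_nonneg[OF q(1)] by (intro sum_mono mult_left_mono) auto
        also have "\<dots> = g + (\<Sum>j<k. split_prob q k j * of_bool (\<xi> < real j * (1 - q)))"
          using sum_split_prob[OF q(1) k] by (simp add: distrib_left sum.distrib flip: sum_distrib_right)
        also have "(\<Sum>j<k. split_prob q k j * of_bool (\<xi> < real j * (1 - q))) =
              (\<Sum>j | j < k \<and> \<xi> < real j * (1 - q). split_prob q k j)"
          by (intro sum.mono_neutral_cong_right) auto
        finally show ?thesis
          using sum_split_prob_tail[OF q k, of \<xi>] by (simp add: e_def)
      qed
      have geo: "(\<Sum>j<k. split_prob q k j * a ^ (k - 1 - j)) \<le> a ^ k / b"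
      proof -
        have aq: "a - q = (1 + \<theta>) * (1 - q)"
          by (simp add: a_def algebra_simps)
        have "(\<Sum>j<k. split_prob q k j * a ^ (k - 1 - j)) = (\<Sum>j<k. q ^ j * a ^ (k - 1 - j)) / qnum q k"
          by (simp add: split_prob_def sum_divide_distrib)
        also have "\<dots> \<le> a ^ k / (a - q) / qnum q k"
        proof (intro divide_right_mono sum_geometric_le)
          show "q < a" using aq t \<theta> mult_pos_pos[of "1 + \<theta>" "1 - q"] by linarith
        qed (use q qnum_nonneg in auto)
        also have "\<dots> = a ^ k / ((1 + \<theta>) * ((1 - q) * qnum q k))"
          by (simp add: aq mult.assoc)
        also have "(1 - q) * qnum q k = 1 - q ^ k"
          by (rule qnum_geometric)
        also have "a ^ k / ((1 + \<theta>) * (1 - q ^ k)) \<le> a ^ k / b"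
        proof (intro divide_left_mono)
          have "q ^ k \<le> exp (- \<xi>)"
            by (rule order_trans[OF power_le_exp[OF q(1)]]) (use False in simp)
          then show *: "b \<le> (1 + \<theta>) * (1 - q ^ k)"
            using \<theta> by (simp add: b_def)
          show "0 < (1 + \<theta>) * (1 - q ^ k) * b"
            by (rule mult_pos_pos[OF less_le_trans[OF b *] b])
        qed (use a in auto)
        finally show ?thesis .
      qed
      have "(\<Sum>j<k. split_prob q k j * height_tail q (m + r) (k - 1 - j)) \<le>
            (\<Sum>j<k. split_prob q k j * ((real r + 1) * e + a ^ (k - 1 - j) / b ^ r))"
        using Suc.prems by (intro sum_mono mult_left_mono Suc.IH split_prob_nonneg q) auto
      also have "\<dots> = (real r + 1) * e + (\<Sum>j<k. split_prob q k j * a ^ (k - 1 - j)) / b ^ r"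
        using sum_split_prob[OF q(1) k]
        by (simp add: distrib_left sum.distrib sum_divide_distrib flip: sum_distrib_right)
      also have "\<dots> \<le> (real r + 1) * e + a ^ k / b / b ^ r"
        using geo b by (intro add_left_mono divide_right_mono) auto
      finally have right: "(\<Sum>j<k. split_prob q k j * height_tail q (m + r) (k - 1 - j)) \<le>
          (real r + 1) * e + a ^ k / b ^ Suc r"
        by simp
      have "height_tail q (m + Suc r) k \<le> e + ((real r + 1) * e + a ^ k / b ^ Suc r)"
        using height_tail_Suc_le[OF q(1) k, of "m + r"] left right by simp
      then show ?thesis
        by (simp add: algebra_simps)
    qed
  qed
  then show ?thesis
    by (simp add: a_def b_def e_def)
qed

text \<open>Larger trees are stochastically higher. The splits of \<open>n\<close> and of \<open>n + 1\<close> can be coupled so that the additional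
  entry joins the left or the right subtree: \<open>\<alpha> j\<close> is the probability that the left subtree has size \<open>j\<close>
  before and after, \<open>\<beta> (Suc j)\<close> that it grows from \<open>j\<close> to \<open>Suc j\<close>. The value of \<open>\<beta>\<close> is the difference
  of the two distribution functions.\<close>
lemma height_cdf_antimono_Suc:
  assumes q: "0 \<le> q" "q \<le> 1"
  shows "height_cdf q m (Suc n) \<le> height_cdf q m n"
proof (induction m arbitrary: n)
  case (Suc m)
  show ?case
  proof (cases "n = 0")
    case True
    then show ?thesis
      using height_cdf_le_1[OF q(1), of "Suc m" "Suc n"] by simp
  next
    case False
    then have n: "n > 0" by simp
    define f where "f = height_cdf q m"
    have f_nonneg: "f j \<ge> 0" for j
      by (simp add: f_def height_cdf_nonneg q)
    have f_anti: "f (Suc j) \<le> f j" for j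
      by (simp add: f_def Suc.IH)
    define D where "D = qnum q n * qnum q (Suc n)"
    define \<alpha> where "\<alpha> = (\<lambda>j. (q ^ j * qnum q (Suc n) - q ^ n * qnum q (Suc j)) / D)"
    define \<beta> where "\<beta> = (\<lambda>j. qnum q j * q ^ n / D)"
    have pos: "qnum q n > 0" "qnum q (Suc n) > 0" "D > 0"
      using qnum_pos[OF q(1)] n by (auto simp: D_def)
    have \<alpha>_nonneg: "\<alpha> j \<ge> 0" if "j \<le> n" for j
    proof -
      have "q ^ n * qnum q (Suc j) \<le> q ^ j * qnum q (Suc n)"
        using that q qnum_nonneg[OF q(1)]
        by (intro mult_mono power_decreasing qnum_mono) auto
      then show ?thesis using pos by (simp add: \<alpha>_def)
    qed
    have \<beta>_nonneg: "\<beta> j \<ge> 0" for j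
      using q qnum_nonneg[OF q(1)] pos by (simp add: \<beta>_def)
    have total_new: "split_prob q (Suc n) j = \<alpha> j + \<beta> j" for j
    proof -
      have "\<alpha> j + \<beta> j = (q ^ j * qnum q n) / D"
        unfolding \<alpha>_def \<beta>_def add_divide_distrib[symmetric]
        by (simp add: qnum_Suc algebra_simps flip: power_add)
      also have "\<dots> = split_prob q (Suc n) j"
        using pos by (simp add: D_def split_prob_def)
      finally show ?thesis by simp
    qed
    have total_old: "split_prob q n j = \<alpha> j + \<beta> (Suc j)" for j
    proof -
      have "\<alpha> j + \<beta> (Suc j) = (q ^ j * qnum q (Suc n)) / D"
        unfolding \<alpha>_def \<beta>_def add_divide_distrib[symmetric]
        by (simp add: algebra_simps)
      also have "\<dots> = split_prob q n j"
        using pos by (simp add: D_def split_prob_def)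
      finally show ?thesis by simp
    qed
    have "height_cdf q (Suc m) (Suc n) = (\<Sum>j<Suc n. (\<alpha> j + \<beta> j) * (f j * f (n - j)))"
      by (simp add: f_def total_new mult.assoc del: sum.lessThan_Suc)
    also have "\<dots> = (\<Sum>j<Suc n. \<alpha> j * (f j * f (n - j))) + (\<Sum>j<Suc n. \<beta> j * (f j * f (n - j)))"
      by (simp add: distrib_right sum.distrib del: sum.lessThan_Suc)
    also have "(\<Sum>j<Suc n. \<alpha> j * (f j * f (n - j))) = (\<Sum>j<n. \<alpha> j * (f j * f (n - j)))"
      by (simp add: \<alpha>_def)
    also have "(\<Sum>j<Suc n. \<beta> j * (f j * f (n - j))) = (\<Sum>j<n. \<beta> (Suc j) * (f (Suc j) * f (n - Suc j)))"
      unfolding sum.lessThan_Suc_shift by (simp add: \<beta>_def qnum_def)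
    also have "(\<Sum>j<n. \<alpha> j * (f j * f (n - j))) + \<dots> \<le>
        (\<Sum>j<n. \<alpha> j * (f j * f (n - 1 - j))) + (\<Sum>j<n. \<beta> (Suc j) * (f j * f (n - 1 - j)))"
    proof (intro add_mono sum_mono mult_left_mono mult_mono order_refl)
      fix j assume j: "j \<in> {..<n}"
      then have "n - j = Suc (n - 1 - j)" by simp
      then show "f (n - j) \<le> f (n - 1 - j)"
        using f_anti[of "n - 1 - j"] by simp
    qed (use f_nonneg f_anti \<alpha>_nonneg \<beta>_nonneg in auto)
    also have "\<dots> = height_cdf q (Suc m) n"
      using n by (simp add: f_def total_old distrib_right sum.distrib mult.assoc)
    finally show ?thesis .
  qed
qed simp

lemma height_cdf_antimono:
  assumes "0 \<le> q" "q \<le> 1" "k \<le> n"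
  shows "height_cdf q m n \<le> height_cdf q m k"
  using assms(3) by (rule lift_Suc_antimono_le[of "height_cdf q m", OF height_cdf_antimono_Suc[OF assms(1,2)]])

text \<open>A tree of size \<open>n\<close> contains, \<open>r\<close> steps along the right spine, a subtree of size at least \<open>k\<close> unless these steps
  remove more than \<open>n - k\<close> entries. The second summand is a Chernoff bound for this event: the number of removed
  entries is stochastically smaller than a sum of \<open>r\<close> geometric variables.\<close>
lemma spine_lower:
  fixes q \<theta> :: real
  assumes q: "0 \<le> q" "q \<le> 1" and \<theta>: "0 < \<theta>" "\<theta> < 1"
  shows "height_cdf q (m + r) n \<le> height_cdf q m k +
           (1 / (1 - \<theta>)) ^ r * (1 + \<theta> * (1 - q)) ^ k / (1 + \<theta> * (1 - q)) ^ n"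
proof -
  define a where "a = 1 + \<theta> * (1 - q)"
  define b where "b = 1 / (1 - \<theta>)"
  have a: "a \<ge> 1" using \<theta> q by (simp add: a_def)
  have b: "b \<ge> 1" using \<theta> by (simp add: b_def)
  have step: "(\<Sum>j<n. split_prob q n j * a ^ Suc j) \<le> b" if n: "n > 0" for n
  proof (cases "q = 1")
    case True
    then show ?thesis
      using sum_split_prob[OF q(1) n] b by (simp add: a_def)
  next
    case False
    then have t: "1 - q > 0" using q by simp
    have \<theta>q: "1 - \<theta> * q > 0"
    proof -
      have "\<theta> * q \<le> \<theta> * 1"
        using \<theta> q by (intro mult_left_mono) auto
      then show ?thesis
        using \<theta> by linarith
    qed
    have "(1 - q) * (1 - \<theta> * q) = 1 - q * a"
      by (simp add: a_def algebra_simps)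
    then have "(1 - q) * (1 - \<theta> * q) * (\<Sum>j<n. (q * a) ^ j) = 1 - (q * a) ^ n"
      by (simp add: one_diff_power_eq)
    also have "\<dots> \<le> 1 - q ^ n"
      using q a mult_left_mono[of 1 "a ^ n" "q ^ n"] by (simp add: power_mult_distrib)
    also have "\<dots> = (1 - q) * qnum q n"
      by (rule qnum_geometric[symmetric])
    finally have "(1 - \<theta> * q) * (\<Sum>j<n. (q * a) ^ j) \<le> qnum q n"
      using t by (simp add: mult.assoc)
    then have S: "(\<Sum>j<n. (q * a) ^ j) / qnum q n \<le> 1 / (1 - \<theta> * q)"
      using \<theta>q qnum_pos[OF q(1) n] by (simp add: field_simps)
    have "(\<Sum>j<n. split_prob q n j * a ^ Suc j) = a * ((\<Sum>j<n. (q * a) ^ j) / qnum q n)"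
      by (simp add: split_prob_def power_mult_distrib sum_distrib_left sum_divide_distrib mult_ac)
    also have "\<dots> \<le> a * (1 / (1 - \<theta> * q))"
      using S a by (intro mult_left_mono) auto
    also have "\<dots> \<le> b"
    proof -
      have "a * (1 - \<theta>) = 1 - \<theta> * q - \<theta>\<^sup>2 * (1 - q)"
        by (simp add: a_def algebra_simps power2_eq_square)
      also have "\<dots> \<le> 1 - \<theta> * q"
        using q by simp
      finally show ?thesis
        using \<theta>q \<theta> by (simp add: b_def field_simps)
    qed
    finally show ?thesis .
  qed
  have "height_cdf q (m + r) n \<le> height_cdf q m k + b ^ r * (a ^ k / a ^ n)"
  proof (induction r arbitrary: n)
    case 0
    show ?case
    proof (cases "k \<le> n")
      case True
      then show ?thesis
        using height_cdf_antimono[OF q True, of m] a by (simp add: add_increasing2)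
    next
      case False
      then have "a ^ n \<le> a ^ k"
        using a by (intro power_increasing) auto
      then have "1 \<le> a ^ k / a ^ n"
        using a by (simp add: le_divide_eq)
      then show ?thesis
        using height_cdf_le_1[OF q(1), of m n] height_cdf_nonneg[OF q(1), of m k] by simp
    qed
  next
    case (Suc r)
    show ?case
    proof (cases "n = 0")
      case True
      have "1 * 1 \<le> b ^ Suc r * a ^ k"
        using a b by (intro mult_mono one_le_power) auto
      then show ?thesis
        using True height_cdf_le_1[OF q(1), of "m + Suc r" n] height_cdf_nonneg[OF q(1), of m k]
        by simp
    next
      case False
      then have n: "n > 0" by simp
      have "height_cdf q (m + Suc r) n =
            (\<Sum>j<n. split_prob q n j * (height_cdf q (m + r) j * height_cdf q (m + r) (n - 1 - j)))"
        using n by (simp add: mult.assoc)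
      also have "\<dots> \<le> (\<Sum>j<n. split_prob q n j * (1 * (height_cdf q m k + b ^ r * (a ^ k / a ^ (n - 1 - j)))))"
        using height_cdf_le_1[OF q(1)] height_cdf_nonneg[OF q(1)]
        by (intro sum_mono mult_left_mono mult_mono Suc.IH split_prob_nonneg q) auto
      also have "\<dots> = (\<Sum>j<n. split_prob q n j * (height_cdf q m k + b ^ r * (a ^ k / a ^ n) * a ^ Suc j))"
      proof (intro sum.cong refl arg_cong2[of _ _ _ _ "(*)"])
        fix j assume "j \<in> {..<n}"
        then have "a ^ n = a ^ (n - 1 - j) * a ^ Suc j"
          unfolding power_add[symmetric] by (intro arg_cong[of _ _ "\<lambda>i. a ^ i"]) auto
        then show "1 * (height_cdf q m k + b ^ r * (a ^ k / a ^ (n - 1 - j))) =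
                   height_cdf q m k + b ^ r * (a ^ k / a ^ n) * a ^ Suc j"
          using a by (simp del: power_Suc)
      qed
      also have "\<dots> = height_cdf q m k + b ^ r * (a ^ k / a ^ n) * (\<Sum>j<n. split_prob q n j * a ^ Suc j)"
      proof -
        have "(\<Sum>j<n. split_prob q n j * (C + D * a ^ Suc j)) = C * (\<Sum>j<n. split_prob q n j) +
              D * (\<Sum>j<n. split_prob q n j * a ^ Suc j)" for C D
          by (simp add: distrib_left sum.distrib sum_distrib_left mult_ac)
        then show ?thesis
          by (simp only: sum_split_prob[OF q(1) n] mult_1_right)
      qed
      also have "\<dots> \<le> height_cdf q m k + b ^ r * (a ^ k / a ^ n) * b"
        using step[OF n] a b by (intro add_left_mono mult_left_mono) auto
      finally show ?thesis
        by (simp add: mult_ac)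
    qed
  qed
  then show ?thesis
    by (simp add: a_def b_def)
qed

section \<open>From positive probability to high probability\<close>
lemma split_prob_lower:
  assumes q: "0 \<le> q" "q \<le> 1" and "j < n" "real n * (1 - q) \<le> \<delta>"
  shows "(1 - \<delta>) / real n \<le> split_prob q n j"
proof -
  have "real j * (1 - q) \<le> real n * (1 - q)"
    using assms by (intro mult_right_mono) auto
  then have "1 - \<delta> \<le> 1 + real j * (q - 1)"
    using assms(4) by (simp add: algebra_simps)
  also have "\<dots> \<le> (1 + (q - 1)) ^ j"
    using q by (intro Bernoulli_inequality) auto
  finally have *: "1 - \<delta> \<le> q ^ j" by simp
  have "qnum q n \<le> real n"
    using sum_mono[of "{..<n}" "\<lambda>i. q ^ i" "\<lambda>_. 1"] q by (simp add: qnum_def power_le_one)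
  moreover have "qnum q n > 0"
    using assms by (intro qnum_pos) auto
  ultimately have "q ^ j / real n \<le> split_prob q n j"
    unfolding split_prob_def using q by (intro divide_left_mono) auto
  moreover have "(1 - \<delta>) / real n \<le> q ^ j / real n"
    using * by (intro divide_right_mono) auto
  ultimately show ?thesis by linarith
qed

text \<open>With probability at least \<open>1 / 4\<close> the split is balanced, so that both subtrees have at least \<open>L\<close> entries and both
  have to be low; in any case one of them has at least \<open>L\<close> entries.\<close>
lemma height_cdf_four_times:
  fixes q :: real and m L :: nat
  assumes q: "0 \<le> q" "q \<le> 1" and L: "L > 0" "real (4 * L) * (1 - q) \<le> 1 / 2"
  defines "x \<equiv> height_cdf q m L"
  shows "height_cdf q m (4 * L) \<le> x * (1 - (1 - x) / 4)"
proof -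
  define n where "n = 4 * L"
  have n: "n > 0" using L by (simp add: n_def)
  define f where "f = height_cdf q m"
  have x: "0 \<le> x" "x \<le> 1"
    using height_cdf_nonneg height_cdf_le_1 q by (auto simp: x_def)
  have f: "0 \<le> f j" "f j \<le> 1" for j
    using height_cdf_nonneg height_cdf_le_1 q by (auto simp: f_def)
  have fL: "f j \<le> x" if "j \<ge> L" for j
    using height_cdf_antimono[OF q that] by (simp add: f_def x_def)
  have prod: "f j * f (n - 1 - j) \<le> x - of_bool (L \<le> j \<and> j < 3 * L) * (x - x * x)" if "j < n" for j
  proof (cases "L \<le> j \<and> j < 3 * L")
    case True
    then have "f j * f (n - 1 - j) \<le> x * x"
      using f x by (intro mult_mono fL) (auto simp: n_def)
    with True show ?thesis by simp
  next
    case False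
    have "f j * f (n - 1 - j) \<le> x * 1 \<or> f j * f (n - 1 - j) \<le> 1 * x"
    proof (cases "L \<le> j")
      case True
      then show ?thesis using f x by (intro disjI1 mult_mono fL) auto
    next
      case False
      then have "L \<le> n - 1 - j" using L by (simp add: n_def)
      then show ?thesis using f x by (intro disjI2 mult_mono fL) auto
    qed
    with False show ?thesis by auto
  qed
  have "f n \<le> height_cdf q (Suc m) n"
    unfolding f_def by (rule height_cdf_Suc_ge[OF q(1)])
  also have "\<dots> = (\<Sum>j<n. split_prob q n j * (f j * f (n - 1 - j)))"
    using n by (simp add: f_def mult.assoc)
  also have "\<dots> \<le> (\<Sum>j<n. split_prob q n j * (x - of_bool (L \<le> j \<and> j < 3 * L) * (x - x * x)))"
    using prod split_prob_nonneg[OF q(1)] by (intro sum_mono mult_left_mono) auto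
  also have "\<dots> = x - (\<Sum>j<n. split_prob q n j * of_bool (L \<le> j \<and> j < 3 * L)) * (x - x * x)"
  proof -
    have "(\<Sum>j<n. split_prob q n j * (x - w j * y)) =
          (\<Sum>j<n. split_prob q n j) * x - (\<Sum>j<n. split_prob q n j * w j) * y" for w y
      by (simp add: sum_distrib_right sum_subtractf right_diff_distrib mult.assoc)
    then show ?thesis
      using sum_split_prob[OF q(1) n] by simp
  qed
  also have "(\<Sum>j<n. split_prob q n j * of_bool (L \<le> j \<and> j < 3 * L)) = (\<Sum>j\<in>{L..<3*L}. split_prob q n j)"
    by (intro sum.mono_neutral_cong_right) (auto simp: n_def)
  also have "x - \<dots> * (x - x * x) \<le> x - (1 / 4) * (x - x * x)"
  proof (intro diff_left_mono mult_right_mono)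
    have "1 / 4 = (\<Sum>j\<in>{L..<3*L}. (1 - 1 / 2) / real n)"
      using L by (simp add: n_def)
    also have "\<dots> \<le> (\<Sum>j\<in>{L..<3*L}. split_prob q n j)"
      using L by (intro sum_mono split_prob_lower q) (auto simp: n_def)
    finally show "1 / 4 \<le> (\<Sum>j\<in>{L..<3*L}. split_prob q n j)" .
    show "0 \<le> x - x * x"
      using x by (simp add: mult_left_le)
  qed
  finally show ?thesis
    by (simp add: f_def n_def algebra_simps)
qed

lemma height_cdf_boost:
  assumes q: "0 \<le> q" "q \<le> 1" and L: "L > 0"
    and tail: "height_tail q m L \<ge> \<eta>" and "\<eta> \<ge> 0"
    and small: "real (4 ^ d * L) * (1 - q) \<le> 1 / 2"
  shows "height_cdf q m (4 ^ d * L) \<le> (1 - \<eta> / 4) ^ d"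
  using small
proof (induction d)
  case 0
  then show ?case using height_cdf_le_1 q by simp
next
  case (Suc d)
  define x where "x = height_cdf q m (4 ^ d * L)"
  have \<eta>: "\<eta> \<le> 1"
    using tail height_tail_le_1[OF q(1), of m L] by linarith
  have "real (4 ^ d * L) * (1 - q) \<le> real (4 ^ Suc d * L) * (1 - q)"
    using q by (intro mult_right_mono) auto
  with Suc have IH: "x \<le> (1 - \<eta> / 4) ^ d"
    by (simp add: x_def)
  have x: "0 \<le> x" "x \<le> 1 - \<eta>"
  proof -
    have "x \<le> height_cdf q m L"
      unfolding x_def by (rule height_cdf_antimono[OF q]) simp
    then show "x \<le> 1 - \<eta>"
      using tail by (simp add: height_tail_def)
  qed (simp add: x_def height_cdf_nonneg q)
  have "height_cdf q m (4 * (4 ^ d * L)) \<le> x * (1 - (1 - x) / 4)"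
    unfolding x_def using Suc.prems L by (intro height_cdf_four_times q) (auto simp: mult.assoc)
  also have "\<dots> \<le> x * (1 - \<eta> / 4)"
    using x by (intro mult_left_mono) auto
  also have "\<dots> \<le> (1 - \<eta> / 4) ^ d * (1 - \<eta> / 4)"
    using IH \<eta> by (intro mult_right_mono) auto
  finally show ?case
    by (simp add: mult_ac)
qed

section \<open>Propagating a positive probability through the scales\<close>
lemma power_div_fact_le_exp:
  assumes "s \<ge> (0::real)"
  shows "s ^ k / fact k \<le> exp s"
proof -
  have "s ^ k /\<^sub>R fact k \<le> (\<Sum>n. s ^ n /\<^sub>R fact n)"
    using assms sum_le_suminf[of "\<lambda>n. s ^ n /\<^sub>R fact n" "{k}"] exp_converges[of s]
    by (auto simp: sums_iff)
  then show ?thesis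
    by (simp add: exp_def divide_inverse mult.commute)
qed

lemma power_diff_le:
  fixes a b :: real
  assumes "0 \<le> b" "b \<le> a"
  shows "a ^ Suc k - b ^ Suc k \<le> real (Suc k) * ((a - b) * a ^ k)"
proof (induction k)
  case (Suc k)
  have "a ^ Suc (Suc k) - b ^ Suc (Suc k) = a * (a ^ Suc k - b ^ Suc k) + (a - b) * b ^ Suc k"
    by (simp add: algebra_simps)
  also have "\<dots> \<le> a * (real (Suc k) * ((a - b) * a ^ k)) + (a - b) * a ^ Suc k"
    using assms Suc by (intro add_mono mult_left_mono power_mono) auto
  also have "\<dots> = real (Suc (Suc k)) * ((a - b) * a ^ Suc k)"
    by (simp add: algebra_simps)
  finally show ?case .
qed simp

text \<open>For uniform splits, the mean number of nodes \<open>i\<close> levels down with subtrees of at least \<open>M\<close> entries,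
  in a tree of \<open>j\<close> entries, is \<open>2 ^ i\<close> times the probability that a product of \<open>i\<close> uniform variables exceeds
  \<open>M / j\<close>. A lower bound for this probability is \<open>(M / j) * s ^ i / fact i\<close> with \<open>s = ln (j / M)\<close>,
  and the functions \<open>s ^ i / fact i\<close> are the iterated integrals of \<open>1 / x\<close>. The shift by \<open>i / M\<close>
  pays for replacing integrals by sums.\<close>
definition log_profile :: "nat \<Rightarrow> nat \<Rightarrow> nat \<Rightarrow> real" where
  "log_profile M i j = max 0 (ln (real j / real M) - real i / real M) ^ i / fact i"

lemma log_profile_nonneg: "log_profile M i j \<ge> 0"
  by (simp add: log_profile_def)

lemma log_profile_step:
  assumes "M > 0" "M \<le> j"
  shows "log_profile M (Suc i) (Suc j) - log_profile M (Suc i) j \<le> log_profile M i j / real j"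
proof -
  define x x' where "x = ln (real j / real M)" and "x' = ln (real (Suc j) / real M)"
  define a b c where "a = max 0 (x' - real (Suc i) / real M)"
    and "b = max 0 (x - real (Suc i) / real M)" and "c = max 0 (x - real i / real M)"
  have j: "real j > 0" using assms by simp
  have mono: "x \<le> x'"
    using assms by (simp add: x_def x'_def divide_right_mono)
  have "real (Suc j) / real M = real j / real M * (1 + 1 / real j)"
    using j by (simp add: distrib_left add_divide_distrib)
  then have "x' = ln (real j / real M * (1 + 1 / real j))"
    unfolding x'_def by (rule arg_cong)
  also have "\<dots> = x + ln (1 + 1 / real j)"
    unfolding x_def using assms j by (intro ln_mult_pos add_pos_pos) auto
  finally have "x' - x = ln (1 + 1 / real j)"
    by simp
  also have "\<dots> \<le> 1 / real j"
    using j by (intro ln_add_one_self_le_self) auto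
  finally have d: "x' \<le> x + 1 / real j" by simp
  have jM: "1 / real j \<le> 1 / real M"
    using assms by (intro divide_left_mono) auto
  have ba: "0 \<le> b" "b \<le> a"
    using mono by (auto simp: a_def b_def)
  have ab: "a - b \<le> 1 / real j"
    using d j mono by (auto simp: a_def b_def max_def)
  have ac: "a \<le> c"
    using d jM by (auto simp: a_def c_def add_divide_distrib)
  have "log_profile M (Suc i) (Suc j) - log_profile M (Suc i) j = (a ^ Suc i - b ^ Suc i) / fact (Suc i)"
    by (simp only: log_profile_def a_def b_def x_def x'_def diff_divide_distrib)
  also have "\<dots> \<le> real (Suc i) * ((a - b) * a ^ i) / fact (Suc i)"
    using power_diff_le[OF ba] by (intro divide_right_mono) auto
  also have "\<dots> = (a - b) * (a ^ i / fact i)"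
    by (simp add: divide_simps del: of_nat_Suc)
  also have "\<dots> \<le> (1 / real j) * (c ^ i / fact i)"
    using ab ac ba by (intro mult_mono divide_right_mono power_mono) auto
  also have "\<dots> = log_profile M i j / real j"
    by (simp add: log_profile_def c_def x_def)
  finally show ?thesis .
qed

lemma log_profile_sum:
  assumes "M > 0" "M \<le> n"
  shows "log_profile M (Suc i) n \<le> (\<Sum>j\<in>{M..<n}. log_profile M i j / real j)"
  using assms(2)
proof (induction n rule: dec_induct)
  case base
  then show ?case using assms(1) by (simp add: log_profile_def)
next
  case (step n)
  then show ?case
    using log_profile_step[OF assms(1) step(1), of i] by simp
qed

text \<open>The profile times \<open>M / j\<close> is dominated by a term of the exponential series of \<open>ln (j / M)\<close>; hence the lower bounds
  for the probabilities below never become large.\<close>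
lemma log_profile_le:
  assumes "M > 0" "M \<le> j"
  shows "real M / real j * log_profile M i j \<le> 1"
proof -
  define s where "s = ln (real j / real M)"
  have s: "s \<ge> 0" and es: "exp s = real j / real M"
    using assms by (auto simp: s_def)
  have "max 0 (s - real i / real M) ^ i \<le> s ^ i"
    using s by (intro power_mono) auto
  then have "log_profile M i j \<le> s ^ i / fact i"
    by (simp add: log_profile_def s_def divide_right_mono)
  also have "\<dots> \<le> exp s"
    by (rule power_div_fact_le_exp[OF s])
  finally show ?thesis
    using assms by (simp add: es field_simps)
qed

text \<open>A lower bound for the nonlinear recursion follows from the linear one as long as all probabilities
  in question stay below \<open>\<delta>\<close>: then at most a fraction \<open>\<delta>\<close> is lost to the event that both
  subtrees are high. Starting from \<open>\<delta> / 2 ^ l\<close> guarantees this for \<open>l\<close> levels. A second factor \<open>1 - \<delta>\<close> is the price for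
  replacing the splitting probabilities by uniform ones.\<close>
lemma height_tail_block:
  fixes q \<delta> :: real
  assumes q: "0 \<le> q" "q \<le> 1" and \<delta>: "0 < \<delta>" "\<delta> \<le> 1" and M: "M > 0"
    and base: "height_tail q m M \<ge> \<delta> / 2 ^ l"
    and N: "real N * (1 - q) \<le> \<delta>"
    and "i \<le> l" "M \<le> n" "n \<le> N"
  shows "height_tail q (m + i) n \<ge>
           \<delta> / 2 ^ l * (2 * (1 - \<delta>)\<^sup>2) ^ i * (real M / real n * log_profile M i n)"
  using \<open>i \<le> l\<close> \<open>M \<le> n\<close> \<open>n \<le> N\<close>
proof (induction i arbitrary: n)
  case 0
  have "real M / real n * log_profile M 0 n \<le> 1"
    by (rule log_profile_le[OF M 0(2)])
  then have "\<delta> / 2 ^ l * (real M / real n * log_profile M 0 n) \<le> \<delta> / 2 ^ l * 1"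
    using \<delta> by (intro mult_left_mono) auto
  also have "\<dots> \<le> height_tail q m n"
    using base height_cdf_antimono[OF q 0(2), of m] by (simp add: height_tail_def)
  finally show ?case by simp
next
  case (Suc i)
  define \<theta> where "\<theta> = 2 * (1 - \<delta>)\<^sup>2"
  have \<theta>: "0 \<le> \<theta>" "\<theta> \<le> 2"
    using \<delta> by (auto simp: \<theta>_def abs_square_le_1 mult_left_le)
  have n: "n > 0" using M Suc.prems by simp
  define C where "C = \<delta> / 2 ^ l * \<theta> ^ i"
  have C0: "C \<ge> 0" using \<delta> \<theta> by (simp add: C_def)
  have C\<delta>: "C \<le> \<delta>"
  proof -
    have "\<theta> ^ i \<le> 2 ^ i"
      using \<theta> by (intro power_mono) auto
    also have "\<dots> \<le> 2 ^ l"
      using Suc.prems by (intro power_increasing) auto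
    finally have "\<delta> * \<theta> ^ i \<le> \<delta> * 2 ^ l"
      using \<delta> by (intro mult_left_mono) auto
    then show ?thesis
      by (simp add: C_def field_simps)
  qed
  define \<phi> where "\<phi> = (\<lambda>j. if j < M then 0 else C * (real M / real j * log_profile M i j))"
  have \<phi>0: "\<phi> j \<ge> 0" for j
    using C0 log_profile_nonneg by (auto simp: \<phi>_def)
  have \<phi>\<delta>: "\<phi> j \<le> \<delta>" for j
    using mult_left_mono[OF log_profile_le[OF M, of j i] C0] C\<delta> \<delta> by (auto simp: \<phi>_def)
  define u where "u = height_tail q (m + i)"
  have u: "\<phi> j \<le> u j" "u j \<le> 1" if "j < n" for j
    using Suc.IH[of j] Suc.prems that height_tail_nonneg[OF q(1)] height_tail_le_1[OF q(1)]
    by (auto simp: \<phi>_def u_def C_def \<theta>_def)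
  have prod: "(1 - \<delta>) * (\<phi> j + \<phi> (n - 1 - j)) \<le> 1 - (1 - u j) * (1 - u (n - 1 - j))" if j: "j < n" for j
  proof -
    have "\<phi> j * \<phi> (n - 1 - j) \<le> \<delta> * \<phi> (n - 1 - j)"
      using \<phi>0 \<phi>\<delta> by (intro mult_right_mono) auto
    moreover have "\<delta> * \<phi> j \<ge> 0"
      using \<delta> \<phi>0 by simp
    ultimately have "(1 - \<delta>) * (\<phi> j + \<phi> (n - 1 - j)) \<le> 1 - (1 - \<phi> j) * (1 - \<phi> (n - 1 - j))"
      by (simp add: algebra_simps)
    also have "\<dots> \<le> 1 - (1 - u j) * (1 - u (n - 1 - j))"
      using j u[OF j] u[of "n - 1 - j"] \<phi>\<delta> \<delta>
      by (intro diff_left_mono mult_mono) (auto intro: order_trans)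
    finally show ?thesis .
  qed
  have nN: "real n * (1 - q) \<le> \<delta>"
  proof -
    have "real n * (1 - q) \<le> real N * (1 - q)"
      using Suc.prems q by (intro mult_right_mono) auto
    with N show ?thesis by simp
  qed
  have "height_tail q (m + Suc i) n =
        (\<Sum>j<n. split_prob q n j * (1 - (1 - u j) * (1 - u (n - 1 - j))))"
    using height_tail_Suc[OF q(1) n, of "m + i"] by (simp add: u_def)
  also have "\<dots> \<ge> (\<Sum>j<n. (1 - \<delta>) / real n * ((1 - \<delta>) * (\<phi> j + \<phi> (n - 1 - j))))"
    using prod \<delta> \<phi>0 nN split_prob_nonneg[OF q(1)]
    by (intro sum_mono mult_mono split_prob_lower q) auto
  also have "(\<Sum>j<n. (1 - \<delta>) / real n * ((1 - \<delta>) * (\<phi> j + \<phi> (n - 1 - j)))) =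
        \<theta> / real n * (\<Sum>j<n. \<phi> j)"
    unfolding sum_distrib_left[symmetric] sum.distrib sum_reflect[of \<phi>]
    by (simp add: \<theta>_def power2_eq_square)
  also have "(\<Sum>j<n. \<phi> j) = (\<Sum>j\<in>{M..<n}. C * real M * (log_profile M i j / real j))"
    by (intro sum.mono_neutral_cong_right) (auto simp: \<phi>_def)
  also have "\<dots> = C * real M * (\<Sum>j\<in>{M..<n}. log_profile M i j / real j)"
    by (simp add: sum_distrib_left)
  finally have 1: "\<theta> / real n * (C * real M * (\<Sum>j\<in>{M..<n}. log_profile M i j / real j))
      \<le> height_tail q (m + Suc i) n" .
  have "\<theta> / real n * (C * real M * log_profile M (Suc i) n) \<le>
        \<theta> / real n * (C * real M * (\<Sum>j\<in>{M..<n}. log_profile M i j / real j))"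
    using log_profile_sum[OF M Suc.prems(2), of i] C0 \<theta> by (intro mult_left_mono) auto
  with 1 show ?case
    by (simp add: C_def \<theta>_def mult_ac)
qed

lemma fact_le_stirling:
  assumes "n > 0"
  shows "fact n \<le> exp 1 * real n * (real n / exp 1) ^ n"
  using assms
proof (induction n rule: nat_induct_non_zero)
  case (Suc n)
  have n: "real n > 0" using Suc by simp
  have "ln (real n / real (Suc n)) \<le> real n / real (Suc n) - 1"
    using n by (intro ln_le_minus_one) auto
  also have "\<dots> = - (1 / real (Suc n))"
    by (simp add: field_simps)
  finally have "real (Suc n) * ln (real n / real (Suc n)) \<le> - 1"
    by (simp add: field_simps)
  then have "exp (real (Suc n) * ln (real n / real (Suc n))) \<le> exp (- 1)"
    by simp
  also have "exp (real (Suc n) * ln (real n / real (Suc n))) = (real n / real (Suc n)) ^ Suc n"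
    using n by (subst exp_of_nat_mult) simp
  finally have *: "real n ^ Suc n \<le> exp (- 1) * real (Suc n) ^ Suc n"
    using n by (simp add: power_divide divide_simps del: power_Suc of_nat_Suc)
  have "fact (Suc n) = real (Suc n) * fact n"
    by simp
  also have "\<dots> \<le> real (Suc n) * (exp 1 * real n * (real n / exp 1) ^ n)"
    using Suc by (intro mult_left_mono) auto
  also have "\<dots> = real (Suc n) * exp 1 * (1 / exp 1) ^ n * real n ^ Suc n"
    by (simp add: power_divide)
  also have "\<dots> \<le> real (Suc n) * exp 1 * (1 / exp 1) ^ n * (exp (- 1) * real (Suc n) ^ Suc n)"
    using * by (intro mult_left_mono) auto
  also have "\<dots> = exp 1 * real (Suc n) * (real (Suc n) / exp 1) ^ Suc n"
    by (simp add: power_divide exp_minus field_simps)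
  finally show ?case .
qed simp

section \<open>The critical constant and subcritical growth rates\<close>
lemma c_star_eq: "c_star * ln (2 * exp 1 / c_star) = 1"
  and c_star_ge_2: "c_star \<ge> 2"
  using theI'[OF c_star_unique] by (simp_all add: c_star_def)

lemma c_star_gt_2: "c_star > 2"
  using c_star_eq c_star_ge_2 by (cases "c_star = 2") auto

text \<open>The form of the equation for the constant that enters the upper bound: with \<open>\<alpha> = c_star - 1\<close>, the potential
  \<open>n powr \<alpha>\<close> and the factor \<open>(2 / (\<alpha> + 1)) ^ m\<close> balance exactly at \<open>m = c_star * ln n\<close>.\<close>
lemma c_star_ln_half: "c_star * ln (c_star / 2) = c_star - 1"
proof -
  have "ln (2 * exp 1 / c_star) = 1 - ln (c_star / 2)"
    using c_star_gt_2 by (simp add: ln_div ln_mult)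
  with c_star_eq have "c_star * (1 - ln (c_star / 2)) = 1"
    by (simp only:)
  then show ?thesis
    by (simp add: right_diff_distrib)
qed

text \<open>The exponential growth rate per level of the mean number of nodes whose subtree sizes shrink by the factor \<open>exp (- 1 / c)\<close> per level.\<close>
lemma subcritical_rate_pos:
  assumes "2 \<le> c" "c < c_star"
  shows "ln (2 * exp 1 / c) - 1 / c > 0"
proof -
  define r where "r = c_star / c"
  have r: "r > 1" using assms by (simp add: r_def)
  have "ln (1 / r) \<le> 1 / r - 1"
    using r by (intro ln_le_minus_one) auto
  then have "1 - 1 / r \<le> ln r"
    using r by (simp add: ln_div)
  moreover have "(1 - 1 / r) / c < (1 - 1 / r) / 1"
    using r assms by (intro divide_strict_left_mono) auto
  ultimately have 1: "(1 - 1 / r) / c < ln r"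
    by simp
  have "ln (2 * exp 1 / c) = ln (2 * exp 1 / c_star) + ln r"
    using assms by (simp add: r_def ln_div ln_mult)
  also have "ln (2 * exp 1 / c_star) = 1 / c_star"
    using c_star_eq c_star_gt_2 by (simp add: field_simps)
  also have "1 / c_star = 1 / r / c"
    using assms by (simp add: r_def)
  finally show ?thesis
    using 1 assms by (simp add: diff_divide_distrib)
qed

text \<open>Blocks of \<open>l\<close> levels are matched with scales: the size grows by the factor \<open>B \<approx> exp (l / c')\<close> per block, where
  \<open>c < c' < c_star\<close>. Supercriticality at \<open>c'\<close> leaves room for the error \<open>\<delta>\<close>, so
  that \<open>height_tail_block\<close> reproduces the same bound \<open>\<eta>\<close> at the next scale. The gap between \<open>c\<close> and \<open>c'\<close>
  absorbs the rounding of \<open>B\<close>.\<close>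
lemma height_tail_positive:
  assumes c: "2 \<le> c" "c < c_star"
  obtains \<eta> \<delta> K where "0 < \<eta>" "0 < \<delta>"
    "\<And>q n m. 0 \<le> q \<Longrightarrow> q \<le> 1 \<Longrightarrow> real n * (1 - q) \<le> \<delta> \<Longrightarrow> real m \<le> c * ln (real n) - K \<Longrightarrow>
       \<eta> \<le> height_tail q m n"
proof -
  \<comment> \<open>An intermediate rate: growth is still supercritical at it, and it exceeds \<open>c\<close> strictly.\<close>
  define c' where "c' = (c + c_star) / 2"
  have c': "2 \<le> c'" "c < c'" "c' < c_star" using c by (auto simp: c'_def)
  define \<kappa> where "\<kappa> = ln (2 * exp 1 / c') - 1 / c'"
  have \<kappa>: "\<kappa> > 0" using subcritical_rate_pos[of c'] c' by (simp add: \<kappa>_def)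
  have "eventually (\<lambda>l. exp (\<kappa> * real l) > 2 * exp 1 * real l) at_top"
    using \<kappa> by real_asymp
  moreover have "eventually (\<lambda>l. real l / c' + ln 2 \<le> real l / c) at_top"
  proof -
    have "1 / c' < 1 / c" using c c' by (intro divide_strict_left_mono) auto
    then have "eventually (\<lambda>l. ln 2 \<le> real l * (1 / c - 1 / c')) at_top"
      by real_asymp
    then show ?thesis
      by eventually_elim (simp add: algebra_simps)
  qed
  ultimately have "eventually (\<lambda>l. exp (\<kappa> * real l) > 2 * exp 1 * real l \<and>
      real l / c' + ln 2 \<le> real l / c \<and> l > 0) at_top"
    using eventually_gt_at_top[of 0] by eventually_elim auto
  then obtain l where l: "exp (\<kappa> * real l) > 2 * exp 1 * real l"
      "real l / c' + ln 2 \<le> real l / c" "l > 0"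
    by (metis (mono_tags, lifting) eventually_happens trivial_limit_at_top_linorder)
  define B where "B = nat \<lceil>exp (real l / c')\<rceil>"
  have lc: "real l / c' > 0" using l c' by simp
  have B_ge: "exp (real l / c') \<le> real B"
    by (simp add: B_def real_nat_ceiling_ge)
  have B_le: "real B \<le> 2 * exp (real l / c')"
  proof -
    have "real B \<le> exp (real l / c') + 1"
      unfolding B_def using of_int_ceiling_le_add_one[of "exp (real l / c')"] by simp
    moreover have "1 \<le> exp (real l / c')" using lc by simp
    ultimately show ?thesis by linarith
  qed
  have B2: "B \<ge> 2"
  proof -
    have "1 < exp (real l / c')" using lc by simp
    then have "1 < real B" using B_ge by linarith
    then show ?thesis by simp
  qed
  have lnB_ge: "real l / c' \<le> ln (real B)"
    using B_ge B2 by (simp add: ln_ge_iff)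
  have lnB_le: "c * ln (real B) \<le> real l"
  proof -
    have "ln (real B) \<le> ln (2 * exp (real l / c'))"
      using B_le B2 by simp
    also have "\<dots> = real l / c' + ln 2"
      by (simp add: ln_mult)
    also have "\<dots> \<le> real l / c" by (rule l)
    finally show ?thesis using c by (simp add: field_simps)
  qed
  have supercritical: "2 ^ l * (1 / real B) * (ln (real B) ^ l / fact l) > 1"
  proof -
    have "1 < exp (\<kappa> * real l) / (2 * exp 1 * real l)"
      using l by simp
    also have "exp (\<kappa> * real l) = (2 * exp 1 / c') ^ l / exp (real l / c')"
    proof -
      have "exp (\<kappa> * real l) = exp (real l * ln (2 * exp 1 / c')) / exp (real l / c')"
        by (simp add: \<kappa>_def algebra_simps exp_diff)
      also have "exp (real l * ln (2 * exp 1 / c')) = (2 * exp 1 / c') ^ l"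
        using c' by (simp add: exp_of_nat_mult)
      finally show ?thesis .
    qed
    also have "(2 * exp 1 / c') ^ l / exp (real l / c') / (2 * exp 1 * real l) =
       2 ^ l * (1 / (2 * exp (real l / c'))) * ((real l / c') ^ l / (exp 1 * real l * (real l / exp 1) ^ l))"
      using l by (simp add: power_divide power_mult_distrib)
    also have "\<dots> \<le> 2 ^ l * (1 / real B) * (ln (real B) ^ l / fact l)"
      using B_le B2 lnB_ge lc fact_le_stirling[OF l(3)]
      by (intro mult_mono mult_left_mono divide_left_mono frac_le power_mono) auto
    finally show ?thesis .
  qed
  \<comment> \<open>The growth of a block as a function of the error; by continuity it stays above \<open>1\<close> for small \<open>\<delta>\<close>.\<close>
  define h where "h = (\<lambda>\<delta>::real. (2 * (1 - \<delta>)\<^sup>2) ^ l * (1 / real B) * (max 0 (ln (real B) - \<delta>) ^ l / fact l))"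
  have "continuous (at 0) h"
    unfolding h_def by (intro continuous_intros) auto
  then have "(h \<longlongrightarrow> h 0) (at 0)"
    by (simp add: isCont_def)
  then have "(h \<longlongrightarrow> h 0) (at_right 0)"
    by (rule filterlim_mono) (auto simp: at_within_le_at)
  moreover have "h 0 > 1"
    using supercritical lc lnB_ge by (simp add: h_def max_def)
  ultimately have "eventually (\<lambda>\<delta>. h \<delta> > 1) (at_right 0)"
    by (rule order_tendstoD)
  moreover have "eventually (\<lambda>\<delta>::real. \<delta> \<in> {0<..<1}) (at_right 0)"
    by (rule eventually_at_right_real) simp
  ultimately have "eventually (\<lambda>\<delta>. h \<delta> > 1 \<and> 0 < \<delta> \<and> \<delta> < 1) (at_right 0)"
    by eventually_elim auto
  then obtain \<delta> where \<delta>: "h \<delta> > 1" "0 < \<delta>" "\<delta> < 1"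
    by (metis (mono_tags, lifting) eventually_happens trivial_limit_at_right_real)
  \<comment> \<open>The initial size is so large that the shift \<open>l / M\<close> in the profile is at most \<open>\<delta>\<close>.\<close>
  define M where "M = nat \<lceil>real l / \<delta>\<rceil>"
  have M_ge: "real l / \<delta> \<le> real M"
    by (simp add: M_def real_nat_ceiling_ge)
  have M0: "M > 0"
  proof -
    have "real l / \<delta> > 0" using l \<delta> by simp
    then show ?thesis using M_ge by (cases M) auto
  qed
  define \<eta> where "\<eta> = \<delta> / 2 ^ l"
  have \<eta>: "0 < \<eta>" "\<eta> \<le> 1"
    using \<delta> by (auto simp: \<eta>_def divide_le_eq intro: order_trans[of _ 1])
  have block: "\<eta> \<le> height_tail q (m + l) (B * M')"
    if q: "0 \<le> q" "q \<le> 1" and "\<eta> \<le> height_tail q m M'" "M \<le> M'" "real (B * M') * (1 - q) \<le> \<delta>"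
    for q m M'
  proof -
    have M': "M' > 0" using M0 that by simp
    have "real l / real M' \<le> real l / real M"
      using M0 M' that by (intro divide_left_mono) auto
    also have "\<dots> \<le> \<delta>"
      using M_ge M0 \<delta> by (simp add: field_simps)
    finally have lM: "real l / real M' \<le> \<delta>" .
    have "\<eta> * 1 \<le> \<eta> * h \<delta>"
      using \<eta> \<delta> by (intro mult_left_mono) auto
    also have "h \<delta> \<le> (2 * (1 - \<delta>)\<^sup>2) ^ l * (1 / real B) * (max 0 (ln (real B) - real l / real M') ^ l / fact l)"
      unfolding h_def using lM
      by (intro mult_left_mono divide_right_mono power_mono mult_nonneg_nonneg) auto
    also have "\<dots> = (2 * (1 - \<delta>)\<^sup>2) ^ l * (real M' / real (B * M') * log_profile M' l (B * M'))"
      using M' by (simp add: log_profile_def)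
    also have "\<eta> * \<dots> \<le> height_tail q (m + l) (B * M')"
      unfolding \<eta>_def mult.assoc[symmetric]
      using height_tail_block[OF q \<delta>(2) _ M', of l m "B * M'" l "B * M'"] that B2 \<delta>
      by (simp add: \<eta>_def mult.assoc)
    finally show ?thesis using \<eta> by simp
  qed
  have iter: "\<eta> \<le> height_tail q (j * l) (B ^ j * M)"
    if q: "0 \<le> q" "q \<le> 1" and "real (B ^ j * M) * (1 - q) \<le> \<delta>" for q j
    using that(3)
  proof (induction j)
    case 0
    then show ?case using \<eta> by (simp add: height_tail_def)
  next
    case (Suc j)
    have le: "B ^ j * M \<le> B ^ Suc j * M"
      using B2 by simp
    then have "real (B ^ j * M) * (1 - q) \<le> real (B ^ Suc j * M) * (1 - q)"
      using q by (intro mult_right_mono of_nat_mono[OF le]) simp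
    then have "\<eta> \<le> height_tail q (j * l) (B ^ j * M)"
      using Suc by linarith
    then have "\<eta> \<le> height_tail q (j * l + l) (B * (B ^ j * M))"
      using Suc.prems B2 by (intro block q) (auto simp: mult.assoc)
    then show ?case
      by (simp add: mult.assoc add.commute)
  qed
  \<comment> \<open>One incomplete block and the initial scale are lost.\<close>
  define K where "K = real l + c * ln (real M)"
  have main: "\<eta> \<le> height_tail q m n"
    if q: "0 \<le> q" "q \<le> 1" and n: "real n * (1 - q) \<le> \<delta>" and m: "real m \<le> c * ln (real n) - K"
    for q n m
  proof -
    have "M \<le> n"
    proof (rule ccontr)
      assume "\<not> M \<le> n"
      then have "ln (real n) \<le> ln (real M)"
        using M0 by (cases "n = 0") auto
      then have "c * ln (real n) \<le> c * ln (real M)"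
        using c by (intro mult_left_mono) auto
      with m l(3) show False
        by (simp add: K_def)
    qed
    define k where "k = (LEAST k. n < B ^ k * M)"
    have "n < 2 ^ n" by (rule less_exp)
    also have "2 ^ n \<le> B ^ n" using B2 by (intro power_mono) auto
    also have "\<dots> \<le> B ^ n * M" using M0 by simp
    finally have ex: "n < B ^ n * M" .
    have k: "n < B ^ k * M"
      unfolding k_def by (rule LeastI[of _ n]) (rule ex)
    have "k \<noteq> 0" using k \<open>M \<le> n\<close> by (cases k) auto
    then obtain j where j: "k = Suc j" by (cases k) auto
    have jn: "B ^ j * M \<le> n"
      using not_less_Least[of j "\<lambda>k. n < B ^ k * M"] j by (simp add: k_def not_less)
    have "real n \<le> real (B ^ Suc j * M)"
      using less_imp_le[OF k] unfolding j by (rule of_nat_mono)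
    then have "ln (real n) \<le> ln (real (B ^ Suc j * M))"
      using M0 \<open>M \<le> n\<close> by (intro ln_mono) auto
    also have "\<dots> = real (Suc j) * ln (real B) + ln (real M)"
      using M0 B2 by (simp add: ln_mult ln_realpow algebra_simps)
    finally have "c * ln (real n) \<le> c * (real (Suc j) * ln (real B) + ln (real M))"
      using c by (intro mult_left_mono) auto
    also have "\<dots> = real (Suc j) * (c * ln (real B)) + c * ln (real M)"
      by (simp add: algebra_simps)
    also have "\<dots> \<le> real (Suc j) * real l + c * ln (real M)"
      using lnB_le by (intro add_right_mono mult_left_mono) auto
    finally have "real m \<le> real (j * l)"
      using m by (simp add: K_def algebra_simps)
    then have "m \<le> j * l" by (simp only: of_nat_le_iff)
    have "real (B ^ j * M) * (1 - q) \<le> real n * (1 - q)"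
      using q by (intro mult_right_mono of_nat_mono[OF jn]) simp
    then have "\<eta> \<le> height_tail q (j * l) (B ^ j * M)"
      using n by (intro iter q) auto
    also have "\<dots> \<le> height_tail q (j * l) n"
      using height_cdf_antimono[OF q jn] by (simp add: height_tail_def)
    also have "\<dots> \<le> height_tail q m n"
      by (rule height_tail_antimono[OF q(1) \<open>m \<le> j * l\<close>])
    finally show ?thesis .
  qed
  show thesis
    by (rule that[OF \<eta>(1) \<delta>(2) main])
qed

section \<open>The upper tail\<close>
definition height_scale :: "nat \<Rightarrow> real \<Rightarrow> real" where
  "height_scale n q = real n * (1 - q) + c_star * ln (real n)"

lemma ln_real_nonneg: "ln (real n) \<ge> 0"
  by (cases "n = 0") auto

lemma height_scale_ge:
  assumes "q \<le> 1"
  shows "real n * (1 - q) \<le> height_scale n q" "c_star * ln (real n) \<le> height_scale n q"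
    "ln (real n) \<le> height_scale n q" "0 \<le> height_scale n q"
proof -
  have 1: "0 \<le> real n * (1 - q)" using assms by simp
  have "1 * ln (real n) \<le> c_star * ln (real n)"
    using c_star_gt_2 ln_real_nonneg by (intro mult_right_mono) auto
  with 1 ln_real_nonneg[of n] show "real n * (1 - q) \<le> height_scale n q" "c_star * ln (real n) \<le> height_scale n q"
    "ln (real n) \<le> height_scale n q" "0 \<le> height_scale n q"
    by (simp_all add: height_scale_def)
qed

lemma height_tail_exponential:
  fixes \<delta> :: real
  assumes \<delta>: "\<delta> > 0"
  obtains \<gamma> where "\<gamma> > 0"
    "\<And>q n m. 0 \<le> q \<Longrightarrow> q \<le> 1 \<Longrightarrow> n > 0 \<Longrightarrow> height_tail q (Suc m) n \<le>
       exp ((ln (1 + \<delta>) - ln (c_star / 2)) * real m + (c_star - 1) * ln (real n) + \<gamma> * (real n * (1 - q)))"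
proof -
  define \<alpha> where "\<alpha> = c_star - 1"
  have \<alpha>: "\<alpha> > 0" using c_star_gt_2 by (simp add: \<alpha>_def)
  define \<gamma> where "\<gamma> = 2 * (\<alpha> + 1) * (1 + 1 / \<delta>)"
  have \<gamma>: "\<gamma> > 0"
    unfolding \<gamma>_def using \<alpha> \<delta> by (intro mult_pos_pos add_pos_pos) auto
  show thesis
  proof (rule that[OF \<gamma>])
    fix q :: real and n m :: nat
    assume q: "0 \<le> q" "q \<le> 1" and n: "n > 0"
    have "height_tail q (Suc m) n \<le>
        (2 * (1 + \<delta>) / (\<alpha> + 1)) ^ m * (real n powr \<alpha> * (1 + \<gamma> * (1 - q)) ^ n)"
      by (rule height_tail_potential[OF q \<alpha> \<delta> \<gamma>_def refl])
    also have "(2 * (1 + \<delta>) / (\<alpha> + 1)) ^ m = exp ((ln (1 + \<delta>) - ln (c_star / 2)) * real m)"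
    proof -
      have "2 * (1 + \<delta>) / (\<alpha> + 1) = exp (ln (1 + \<delta>) - ln (c_star / 2))"
        using \<delta> c_star_gt_2 by (simp add: exp_diff \<alpha>_def)
      then show ?thesis
        by (simp add: exp_of_nat2_mult)
    qed
    also have "real n powr \<alpha> * (1 + \<gamma> * (1 - q)) ^ n \<le> exp (\<alpha> * ln (real n)) * exp (\<gamma> * (real n * (1 - q)))"
    proof (intro mult_mono)
      have "(1 + \<gamma> * (1 - q)) ^ n \<le> exp (\<gamma> * (1 - q)) ^ n"
        using \<gamma> q by (intro power_mono exp_ge_add_one_self) auto
      then show "(1 + \<gamma> * (1 - q)) ^ n \<le> exp (\<gamma> * (real n * (1 - q)))"
        by (simp add: mult_ac flip: exp_of_nat_mult)
    qed (use n \<gamma> q in \<open>auto simp: powr_def\<close>)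
    finally show "height_tail q (Suc m) n \<le>
       exp ((ln (1 + \<delta>) - ln (c_star / 2)) * real m + (c_star - 1) * ln (real n) + \<gamma> * (real n * (1 - q)))"
      by (simp add: exp_add \<alpha>_def mult.assoc)
  qed
qed

text \<open>Far above the typical height a crude choice of \<open>\<delta>\<close> suffices: \<open>1 + \<delta> < c_star / 2\<close> makes the factor per
  level smaller than \<open>1\<close>, and the remaining terms are at most a multiple of the scale.\<close>
lemma height_tail_large_deviation:
  obtains \<rho> \<gamma> where "\<rho> > 0"
    "\<And>q n m. 0 \<le> q \<Longrightarrow> q \<le> 1 \<Longrightarrow> n > 0 \<Longrightarrow>
       height_tail q (Suc m) n \<le> exp (\<gamma> * height_scale n q - \<rho> * real m)"
proof -
  define \<delta> where "\<delta> = (c_star / 2 - 1) / 2"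
  have \<delta>: "\<delta> > 0" "1 + \<delta> < c_star / 2"
    using c_star_gt_2 by (simp_all add: \<delta>_def field_simps)
  define \<rho> where "\<rho> = ln (c_star / 2) - ln (1 + \<delta>)"
  have \<rho>: "\<rho> > 0"
    using \<delta> by (simp add: \<rho>_def)
  obtain \<gamma> where \<gamma>: "\<gamma> > 0" "\<And>q n m. 0 \<le> q \<Longrightarrow> q \<le> 1 \<Longrightarrow> n > 0 \<Longrightarrow> height_tail q (Suc m) n \<le>
       exp ((ln (1 + \<delta>) - ln (c_star / 2)) * real m + (c_star - 1) * ln (real n) + \<gamma> * (real n * (1 - q)))"
    using height_tail_exponential[OF \<delta>(1)] by blast
  show thesis
  proof (rule that[OF \<rho>, of "1 + \<gamma>"])
    fix q :: real and n m :: nat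
    assume q: "0 \<le> q" "q \<le> 1" and n: "n > 0"
    have "height_tail q (Suc m) n \<le>
      exp ((ln (1 + \<delta>) - ln (c_star / 2)) * real m + (c_star - 1) * ln (real n) + \<gamma> * (real n * (1 - q)))"
      by (rule \<gamma>(2)[OF q n])
    also have "\<dots> \<le> exp ((1 + \<gamma>) * height_scale n q - \<rho> * real m)"
    proof -
      have "(c_star - 1) * ln (real n) \<le> height_scale n q"
        using height_scale_ge(2)[OF q(2), of n] ln_real_nonneg[of n] by (simp add: algebra_simps)
      moreover have "\<gamma> * (real n * (1 - q)) \<le> \<gamma> * height_scale n q"
        using height_scale_ge(1)[OF q(2), of n] \<gamma> by (intro mult_left_mono) auto
      ultimately show ?thesis
        by (simp add: \<rho>_def algebra_simps)
    qed
    finally show "height_tail q (Suc m) n \<le> exp ((1 + \<gamma>) * height_scale n q - \<rho> * real m)" .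
  qed
qed

text \<open>For small subtrees the term \<open>\<gamma> * (k * (1 - q))\<close> is a small multiple of the scale \<open>L\<close>, and the balance expressed by
  \<open>c_star_ln_half\<close> leaves the error \<open>ln (1 + \<delta>) * c_star * ln n \<le> \<delta> L\<close>. The excess \<open>\<epsilon> L\<close> of levels gains
  at least three quarters of \<open>\<epsilon> h L\<close>, where \<open>h = ln (c_star / 2)\<close>; each of the two errors is at most one quarter of it.\<close>
lemma height_tail_small_subtree:
  fixes \<epsilon> :: real
  assumes \<epsilon>: "0 < \<epsilon>" "\<epsilon> \<le> 1"
  obtains \<zeta> \<omega> where "\<zeta> > 0" "\<omega> > 0"
    "\<And>q n k m. 0 \<le> q \<Longrightarrow> q \<le> 1 \<Longrightarrow> k \<le> n \<Longrightarrow> real k * (1 - q) \<le> \<zeta> * height_scale n q \<Longrightarrow>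
       c_star * ln (real n) + \<epsilon> * height_scale n q \<le> real m \<Longrightarrow>
       height_tail q (Suc m) k \<le> exp (- \<omega> * height_scale n q)"
proof -
  define h where "h = ln (c_star / 2)"
  have h: "h > 0" using c_star_gt_2 by (simp add: h_def)
  define \<delta> where "\<delta> = \<epsilon> * h / 4"
  have \<delta>: "\<delta> > 0" "\<delta> \<le> h / 4"
    using \<epsilon> h by (auto simp: \<delta>_def)
  define \<rho> where "\<rho> = h - ln (1 + \<delta>)"
  have ln\<delta>: "ln (1 + \<delta>) \<le> \<delta>"
    using \<delta> by (intro ln_add_one_self_le_self) auto
  have \<rho>: "\<rho> \<ge> 3 / 4 * h" using ln\<delta> \<delta> by (simp add: \<rho>_def)
  obtain \<gamma> where \<gamma>: "\<gamma> > 0" "\<And>q n m. 0 \<le> q \<Longrightarrow> q \<le> 1 \<Longrightarrow> n > 0 \<Longrightarrow> height_tail q (Suc m) n \<le>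
       exp ((ln (1 + \<delta>) - ln (c_star / 2)) * real m + (c_star - 1) * ln (real n) + \<gamma> * (real n * (1 - q)))"
    using height_tail_exponential[OF \<delta>(1)] by blast
  define \<zeta> where "\<zeta> = \<epsilon> * h / (4 * \<gamma>)"
  have \<zeta>: "\<zeta> > 0" using \<epsilon> h \<gamma> by (simp add: \<zeta>_def)
  define \<omega> where "\<omega> = \<epsilon> * h / 4"
  have \<omega>: "\<omega> > 0" using \<epsilon> h by (simp add: \<omega>_def)
  show thesis
  proof (rule that[OF \<zeta> \<omega>])
    fix q :: real and n k m :: nat
    assume q: "0 \<le> q" "q \<le> 1" and k: "k \<le> n" and small: "real k * (1 - q) \<le> \<zeta> * height_scale n q"
      and m: "c_star * ln (real n) + \<epsilon> * height_scale n q \<le> real m"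
    show "height_tail q (Suc m) k \<le> exp (- \<omega> * height_scale n q)"
    proof (cases "k = 0")
      case False
      define L where "L = height_scale n q"
      have L: "L \<ge> 0" "c_star * ln (real n) \<le> L"
        using height_scale_ge[OF q(2), of n] by (simp_all add: L_def)
      have "height_tail q (Suc m) k \<le>
         exp ((ln (1 + \<delta>) - ln (c_star / 2)) * real m + (c_star - 1) * ln (real k) + \<gamma> * (real k * (1 - q)))"
        using False by (intro \<gamma> q) auto
      also have "(ln (1 + \<delta>) - ln (c_star / 2)) * real m + (c_star - 1) * ln (real k) + \<gamma> * (real k * (1 - q))
         \<le> - \<omega> * L"
      proof -
        have "(ln (1 + \<delta>) - ln (c_star / 2)) * real m \<le> - \<rho> * (c_star * ln (real n) + \<epsilon> * L)"
          using mult_left_mono[OF m, of \<rho>] \<rho> h by (simp add: \<rho>_def h_def L_def algebra_simps)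
        moreover have "\<rho> * (c_star * ln (real n)) = (c_star - 1) * ln (real n) - ln (1 + \<delta>) * (c_star * ln (real n))"
        proof -
          have "\<rho> * c_star = (c_star - 1) - ln (1 + \<delta>) * c_star"
            using c_star_ln_half by (simp add: \<rho>_def h_def algebra_simps)
          then have "\<rho> * c_star * ln (real n) = ((c_star - 1) - ln (1 + \<delta>) * c_star) * ln (real n)"
            by (rule arg_cong)
          then show ?thesis
            by (simp add: algebra_simps)
        qed
        moreover have "ln (1 + \<delta>) * (c_star * ln (real n)) \<le> \<delta> * L"
        proof (rule mult_mono)
          show "0 \<le> c_star * ln (real n)"
            using c_star_gt_2 ln_real_nonneg[of n] by simp
        qed (use L ln\<delta> \<delta> in auto)
        moreover have "(c_star - 1) * ln (real k) \<le> (c_star - 1) * ln (real n)"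
          using False k c_star_gt_2 by (intro mult_left_mono ln_mono) auto
        moreover have "\<gamma> * (real k * (1 - q)) \<le> \<epsilon> * h / 4 * L"
          using mult_left_mono[OF small, of \<gamma>] \<gamma>(1) by (simp add: \<zeta>_def L_def)
        moreover have "\<rho> * (\<epsilon> * L) \<ge> 3 / 4 * h * (\<epsilon> * L)"
          using \<rho> \<epsilon> L by (intro mult_right_mono) auto
        ultimately show ?thesis
          unfolding \<omega>_def \<delta>_def by (simp add: algebra_simps)
      qed
      finally show ?thesis by (simp add: L_def)
    qed (simp add: height_tail_Suc_0)
  qed
qed

text \<open>The excess \<open>\<epsilon> L\<close> is shared among the right spine, the small subtrees and the rounding. Each event in \<open>spine_upper\<close>
  is exponentially unlikely in \<open>L\<close>, which outweighs the number of stages, of order \<open>L\<close>.\<close>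
lemma height_upper_tail:
  fixes \<epsilon> \<eta> :: real
  assumes \<epsilon>: "0 < \<epsilon>" "\<epsilon> \<le> 1" and \<eta>: "\<eta> > 0"
  obtains L0 where
    "\<And>q n m. 0 \<le> q \<Longrightarrow> q \<le> 1 \<Longrightarrow> n > 0 \<Longrightarrow> height_scale n q \<ge> L0 \<Longrightarrow>
       (1 + \<epsilon>) * height_scale n q \<le> real m \<Longrightarrow> height_tail q m n \<le> \<eta>"
proof -
  define e where "e = \<epsilon> / 3"
  have e: "0 < e" "e \<le> 1" using \<epsilon> by (auto simp: e_def)
  obtain \<zeta> \<omega> where \<zeta>: "\<zeta> > 0" and \<omega>: "\<omega> > 0" and small:
    "\<And>q n k m. 0 \<le> q \<Longrightarrow> q \<le> 1 \<Longrightarrow> k \<le> n \<Longrightarrow> real k * (1 - q) \<le> \<zeta> * height_scale n q \<Longrightarrow>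
       c_star * ln (real n) + e * height_scale n q \<le> real m \<Longrightarrow>
       height_tail q (Suc m) k \<le> exp (- \<omega> * height_scale n q)"
    using height_tail_small_subtree[OF e] by blast
  \<comment> \<open>So small that \<open>2 * \<theta>\<^sup>2\<close>, the loss on the spine, is less than the gain \<open>3 / 4 * \<theta> * e\<close> from the excess.\<close>
  define \<theta> where "\<theta> = e / 8"
  have \<theta>: "0 < \<theta>" "\<theta> \<le> 1 / 8" using e by (auto simp: \<theta>_def)
  \<comment> \<open>As \<open>\<theta> - \<theta>\<^sup>2 \<le> ln (1 + \<theta>)\<close>, the margin \<open>\<theta>\<^sup>2\<close> absorbs the factor \<open>1 - exp (- (\<zeta> * L))\<close>.\<close>
  define p where "p = \<theta> - 2 * \<theta>\<^sup>2"
  have p: "p \<ge> 3 / 4 * \<theta>"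
    using mult_left_mono[OF \<theta>(2), of \<theta>] \<theta> by (simp add: p_def power2_eq_square)
  define c where "c = \<theta> * e / 2"
  have c: "c > 0" using \<theta> e by (simp add: c_def)
  have "eventually (\<lambda>L. 1 \<le> L) (at_top :: real filter)"
    by (rule eventually_ge_at_top)
  moreover have "eventually (\<lambda>L. 3 \<le> e * L) at_top"
    using e by real_asymp
  moreover have "eventually (\<lambda>L. (2 * L + 2) * (exp (- \<omega> * L) + exp (- (\<zeta> * L))) + exp (- c * L) < \<eta>) at_top"
  proof (rule order_tendstoD(2))
    show "((\<lambda>L. (2 * L + 2) * (exp (- \<omega> * L) + exp (- (\<zeta> * L))) + exp (- c * L)) \<longlongrightarrow> 0) at_top"
    proof -
      have decay: "((\<lambda>L. (2 * L + 2) * exp (- (a * L))) \<longlongrightarrow> 0) at_top" if "a > 0" for a :: real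
        using that by real_asymp
      have "((\<lambda>L. exp (- c * L)) \<longlongrightarrow> 0) at_top"
        using c by real_asymp
      from tendsto_add[OF tendsto_add[OF decay[OF \<omega>] decay[OF \<zeta>]] this] show ?thesis
        by (simp add: distrib_left)
    qed
  qed (rule \<eta>)
  moreover have "eventually (\<lambda>L. (1 + \<theta>) * (1 - exp (- (\<zeta> * L))) > exp p) at_top"
  proof (rule order_tendstoD(1))
    show "((\<lambda>L. (1 + \<theta>) * (1 - exp (- (\<zeta> * L)))) \<longlongrightarrow> (1 + \<theta>)) at_top"
      using \<zeta> by real_asymp
    have "p < \<theta> - \<theta>\<^sup>2" using \<theta> by (simp add: p_def)
    also have "\<dots> \<le> ln (1 + \<theta>)"
      using \<theta> by (intro ln_one_plus_pos_lower_bound) auto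
    finally have "exp p < exp (ln (1 + \<theta>))"
      by (simp only: exp_less_cancel_iff)
    then show "exp p < 1 + \<theta>" using \<theta> by simp
  qed
  ultimately have "eventually (\<lambda>L. 1 \<le> L \<and> 3 \<le> e * L \<and>
      (2 * L + 2) * (exp (- \<omega> * L) + exp (- (\<zeta> * L))) + exp (- c * L) < \<eta> \<and>
      (1 + \<theta>) * (1 - exp (- (\<zeta> * L))) > exp p) at_top"
    by eventually_elim auto
  then obtain L0 where L0: "\<And>L. L \<ge> L0 \<Longrightarrow> 1 \<le> L \<and> 3 \<le> e * L \<and>
      (2 * L + 2) * (exp (- \<omega> * L) + exp (- (\<zeta> * L))) + exp (- c * L) < \<eta> \<and>
      (1 + \<theta>) * (1 - exp (- (\<zeta> * L))) > exp p"
    unfolding eventually_at_top_linorder by blast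
  show thesis
  proof (rule that[of L0])
    fix q :: real and n m :: nat
    assume q: "0 \<le> q" "q \<le> 1" and n: "n > 0" and LL0: "height_scale n q \<ge> L0"
      and m: "(1 + \<epsilon>) * height_scale n q \<le> real m"
    define L where "L = height_scale n q"
    define x where "x = real n * (1 - q)"
    have x: "0 \<le> x" "x \<le> L" using height_scale_ge(1)[OF q(2), of n] q by (auto simp: x_def L_def)
    have Lx: "L = x + c_star * ln (real n)" by (simp add: L_def x_def height_scale_def)
    have lnn: "c_star * ln (real n) \<ge> 0"
      using c_star_gt_2 ln_real_nonneg by simp
    from LL0 L0[of L] have L: "1 \<le> L" "3 \<le> e * L"
      "(2 * L + 2) * (exp (- \<omega> * L) + exp (- (\<zeta> * L))) + exp (- c * L) < \<eta>"
      "(1 + \<theta>) * (1 - exp (- (\<zeta> * L))) > exp p"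
      by (auto simp: L_def)
    have eL: "e * L \<le> L" using e L(1) by simp
    define m0 where "m0 = nat \<lceil>c_star * ln (real n) + e * L\<rceil>"
    define r where "r = nat \<lceil>x + e * L\<rceil>"
    have m0: "c_star * ln (real n) + e * L \<le> real m0" "real m0 \<le> c_star * ln (real n) + e * L + 1"
      using lnn L(2) by (simp_all add: m0_def real_nat_ceiling_ge of_int_ceiling_le_add_one)
    have r: "x + e * L \<le> real r" "real r \<le> x + e * L + 1"
      using x L(2) by (simp_all add: r_def real_nat_ceiling_ge of_int_ceiling_le_add_one)
    have "real (Suc m0 + r) \<le> (1 + 2 * e) * L + 3"
      using m0 r by (simp add: Lx algebra_simps)
    also have "\<dots> \<le> (1 + \<epsilon>) * L"
      using L(2) by (simp add: e_def algebra_simps)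
    also have "\<dots> \<le> real m"
      using m by (simp add: L_def)
    finally have "Suc m0 + r \<le> m" by (simp only: of_nat_le_iff)
    then have "height_tail q m n \<le> height_tail q (Suc m0 + r) n"
      by (rule height_tail_antimono[OF q(1)])
    also have "\<dots> \<le> (real r + 1) * (exp (- \<omega> * L) + exp (- (\<zeta> * L))) +
           (1 + \<theta> * (1 - q)) ^ n / ((1 + \<theta>) * (1 - exp (- (\<zeta> * L)))) ^ r"
    proof (rule spine_upper[OF q])
      fix k assume "k \<le> n" "real k * (1 - q) \<le> \<zeta> * L"
      then show "height_tail q (Suc m0) k \<le> exp (- \<omega> * L)"
        using m0 unfolding L_def by (intro small q) auto
    qed (use \<zeta> \<theta> L in auto)
    also have "\<dots> \<le> (2 * L + 2) * (exp (- \<omega> * L) + exp (- (\<zeta> * L))) + exp (- c * L)"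
    proof (rule add_mono[OF mult_right_mono])
      show "real r + 1 \<le> 2 * L + 2" using r(2) x(2) eL by (simp add: algebra_simps)
      have "(1 + \<theta> * (1 - q)) ^ n / ((1 + \<theta>) * (1 - exp (- (\<zeta> * L)))) ^ r \<le> exp (\<theta> * x) / exp (p * (x + e * L))"
      proof (rule frac_le)
        have "(1 + \<theta> * (1 - q)) ^ n \<le> exp (\<theta> * (1 - q)) ^ n"
          using \<theta> q by (intro power_mono exp_ge_add_one_self) auto
        then show "(1 + \<theta> * (1 - q)) ^ n \<le> exp (\<theta> * x)"
          by (simp add: x_def mult_ac flip: exp_of_nat_mult)
        have "exp (p * (x + e * L)) \<le> exp (p * real r)"
          using r p \<theta> by simp
        also have "\<dots> = exp p ^ r"
          by (simp add: exp_of_nat2_mult)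
        also have "\<dots> \<le> ((1 + \<theta>) * (1 - exp (- (\<zeta> * L)))) ^ r"
          using L(4) by (intro power_mono) auto
        finally show "exp (p * (x + e * L)) \<le> ((1 + \<theta>) * (1 - exp (- (\<zeta> * L)))) ^ r" .
      qed auto
      also have "\<dots> = exp (\<theta> * x - p * (x + e * L))"
        by (simp add: exp_diff)
      also have "\<theta> * x - p * (x + e * L) \<le> - c * L"
      proof -
        have "\<theta> * x - p * (x + e * L) = 2 * \<theta>\<^sup>2 * x - p * (e * L)"
          by (simp add: p_def algebra_simps)
        also have "\<dots> \<le> 2 * \<theta>\<^sup>2 * L - (3 / 4 * \<theta>) * (e * L)"
          using x p L e by (intro diff_mono mult_left_mono mult_right_mono) auto
        also have "\<dots> = - c * L"
          by (simp add: c_def \<theta>_def power2_eq_square)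
        finally show ?thesis .
      qed
      finally show "(1 + \<theta> * (1 - q)) ^ n / ((1 + \<theta>) * (1 - exp (- (\<zeta> * L)))) ^ r \<le> exp (- c * L)"
        by simp
    qed auto
    also have "\<dots> \<le> \<eta>" using L(3) by simp
    finally show "height_tail q m n \<le> \<eta>" .
  qed
qed

section \<open>The lower tail\<close>

text \<open>Along the spine, \<open>r\<close> falls short of the mean number of steps needed to remove all but \<open>\<epsilon> n\<close> entries by a proportion
  of order \<open>\<epsilon>\<close>. Subtracting \<open>\<epsilon> * ln n\<close> as well makes the error decay with \<open>n\<close> whatever the size of
  \<open>n (1 - q)\<close>: if \<open>n (1 - q)\<close> is below \<open>\<epsilon> * ln n\<close>, no step is taken at all.\<close>
lemma spine_lower_bound:
  fixes q \<epsilon> :: real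
  assumes q: "0 \<le> q" "q \<le> 1" and \<epsilon>: "0 < \<epsilon>" "\<epsilon> \<le> 1 / 2" and k: "real k \<le> \<epsilon> * real n"
  defines "r \<equiv> nat \<lfloor>(1 - 2 * \<epsilon>) * (real n * (1 - q)) - \<epsilon> * ln (real n)\<rfloor>"
  shows "height_cdf q (m + r) n \<le> height_cdf q m k + exp (- (\<epsilon>\<^sup>2 / 3 * ln (real n)))"
proof (cases "r = 0")
  case True
  have "\<epsilon> * real n \<le> 1 * real n"
    using \<epsilon> by (intro mult_right_mono) auto
  then have "k \<le> n" using k by simp
  then show ?thesis
    using True height_cdf_antimono[OF q \<open>k \<le> n\<close>, of m] by (simp add: add_increasing2)
next
  case False
  define x where "x = real n * (1 - q)"
  \<comment> \<open>With \<open>\<epsilon> = 3 * \<theta>\<close>, the terms of order \<open>\<theta> * \<epsilon> * x\<close> and \<open>\<theta>\<^sup>2 * x\<close> in the exponent cancel.\<close>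
  define \<theta> where "\<theta> = \<epsilon> / 3"
  have \<theta>: "0 < \<theta>" "\<theta> \<le> 1 / 6" using \<epsilon> by (auto simp: \<theta>_def)
  have x: "x \<ge> 0" using q by (simp add: x_def)
  have r: "real r \<le> (1 - 2 * \<epsilon>) * x - \<epsilon> * ln (real n)"
    using False unfolding r_def x_def by linarith
  have kn: "k \<le> n"
  proof -
    have "\<epsilon> * real n \<le> 1 * real n"
      using \<epsilon> by (intro mult_right_mono) auto
    then show "k \<le> n" using k by simp
  qed
  define a where "a = 1 + \<theta> * (1 - q)"
  have a: "a \<ge> 1" using \<theta> q by (simp add: a_def)
  have b_le: "(1 / (1 - \<theta>)) ^ r \<le> exp ((\<theta> + 2 * \<theta>\<^sup>2) * ((1 - 2 * \<epsilon>) * x - \<epsilon> * ln (real n)))"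
  proof -
    have "- \<theta> - 2 * \<theta>\<^sup>2 \<le> ln (1 - \<theta>)"
      using \<theta> by (intro ln_one_minus_pos_lower_bound) auto
    then have "exp (- (\<theta> + 2 * \<theta>\<^sup>2)) \<le> exp (ln (1 - \<theta>))"
      by simp
    then have "exp (- (\<theta> + 2 * \<theta>\<^sup>2)) \<le> 1 - \<theta>"
      using \<theta> by simp
    then have "1 / (1 - \<theta>) \<le> 1 / exp (- (\<theta> + 2 * \<theta>\<^sup>2))"
      by (intro divide_left_mono) (use \<theta> in auto)
    also have "\<dots> = exp (\<theta> + 2 * \<theta>\<^sup>2)"
      by (simp only: exp_minus inverse_inverse_eq divide_inverse mult_1_left)
    finally have "(1 / (1 - \<theta>)) ^ r \<le> exp (\<theta> + 2 * \<theta>\<^sup>2) ^ r"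
      using \<theta> by (intro power_mono) auto
    also have "\<dots> = exp ((\<theta> + 2 * \<theta>\<^sup>2) * real r)"
      by (simp add: exp_of_nat2_mult)
    also have "\<dots> \<le> exp ((\<theta> + 2 * \<theta>\<^sup>2) * ((1 - 2 * \<epsilon>) * x - \<epsilon> * ln (real n)))"
      using r \<theta> by (subst exp_le_cancel_iff) (intro mult_left_mono, auto)
    finally show ?thesis .
  qed
  have a_ge: "exp ((\<theta> - \<theta>\<^sup>2) * ((1 - \<epsilon>) * x)) \<le> a ^ (n - k)"
  proof -
    define y where "y = \<theta> * (1 - q)"
    have y: "0 \<le> y" "y \<le> 1"
      using \<theta> q mult_mono[of \<theta> 1 "1 - q" 1] by (auto simp: y_def)
    have "(1 - q)\<^sup>2 \<le> 1 - q"
      using q by (simp add: power2_eq_square mult_left_le)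
    then have "\<theta>\<^sup>2 * (1 - q)\<^sup>2 \<le> \<theta>\<^sup>2 * (1 - q)"
      by (intro mult_left_mono) auto
    moreover have "y\<^sup>2 = \<theta>\<^sup>2 * (1 - q)\<^sup>2" "(\<theta> - \<theta>\<^sup>2) * (1 - q) = y - \<theta>\<^sup>2 * (1 - q)"
      by (simp_all add: y_def power_mult_distrib left_diff_distrib)
    ultimately have "(\<theta> - \<theta>\<^sup>2) * (1 - q) \<le> y - y\<^sup>2"
      by linarith
    also have "\<dots> \<le> ln a"
      using ln_one_plus_pos_lower_bound[OF y] by (simp add: a_def y_def)
    finally have 1: "(\<theta> - \<theta>\<^sup>2) * (1 - q) \<le> ln a" .
    have "(1 - \<epsilon>) * x \<le> real (n - k) * (1 - q)"
    proof -
      have "(1 - \<epsilon>) * real n \<le> real (n - k)"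
        using k kn by (simp add: of_nat_diff algebra_simps)
      then have "(1 - \<epsilon>) * real n * (1 - q) \<le> real (n - k) * (1 - q)"
        using q by (intro mult_right_mono) auto
      then show ?thesis by (simp add: x_def mult.assoc)
    qed
    then have "(\<theta> - \<theta>\<^sup>2) * ((1 - \<epsilon>) * x) \<le> (\<theta> - \<theta>\<^sup>2) * (real (n - k) * (1 - q))"
      using \<theta> by (intro mult_left_mono) (auto simp: power2_eq_square mult_left_le)
    also have "\<dots> = real (n - k) * ((\<theta> - \<theta>\<^sup>2) * (1 - q))"
      by (simp add: mult_ac)
    also have "\<dots> \<le> real (n - k) * ln a"
      using 1 by (intro mult_left_mono) auto
    finally have "exp ((\<theta> - \<theta>\<^sup>2) * ((1 - \<epsilon>) * x)) \<le> exp (real (n - k) * ln a)"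
      by simp
    also have "\<dots> = a ^ (n - k)"
      using a by (simp add: exp_of_nat_mult)
    finally show ?thesis .
  qed
  have "(1 / (1 - \<theta>)) ^ r * a ^ k / a ^ n = (1 / (1 - \<theta>)) ^ r / a ^ (n - k)"
  proof -
    have "a ^ n = a ^ (n - k) * a ^ k"
      using kn by (simp flip: power_add)
    then show ?thesis using a by simp
  qed
  also have "\<dots> \<le> exp ((\<theta> + 2 * \<theta>\<^sup>2) * ((1 - 2 * \<epsilon>) * x - \<epsilon> * ln (real n))) / exp ((\<theta> - \<theta>\<^sup>2) * ((1 - \<epsilon>) * x))"
    by (rule frac_le[OF _ b_le _ a_ge]) auto
  also have "\<dots> = exp ((\<theta> + 2 * \<theta>\<^sup>2) * ((1 - 2 * \<epsilon>) * x - \<epsilon> * ln (real n)) - (\<theta> - \<theta>\<^sup>2) * ((1 - \<epsilon>) * x))"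
    by (simp add: exp_diff)
  also have "(\<theta> + 2 * \<theta>\<^sup>2) * ((1 - 2 * \<epsilon>) * x - \<epsilon> * ln (real n)) - (\<theta> - \<theta>\<^sup>2) * ((1 - \<epsilon>) * x)
      \<le> - (\<theta> * \<epsilon> * ln (real n))"
  proof -
    have "\<epsilon> = 3 * \<theta>" by (simp add: \<theta>_def)
    then have "(\<theta> + 2 * \<theta>\<^sup>2) * ((1 - 2 * \<epsilon>) * x - \<epsilon> * ln (real n)) - (\<theta> - \<theta>\<^sup>2) * ((1 - \<epsilon>) * x) =
        - (\<theta> * \<epsilon> * ln (real n)) - 15 * \<theta> ^ 3 * x - 6 * \<theta> ^ 3 * ln (real n)"
      by (simp add: algebra_simps power2_eq_square power3_eq_cube)
    moreover have "0 \<le> \<theta> ^ 3 * x" "0 \<le> \<theta> ^ 3 * ln (real n)"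
      using \<theta> x ln_real_nonneg[of n] by simp_all
    ultimately show ?thesis
      by linarith
  qed
  also have "\<theta> * \<epsilon> * ln (real n) = \<epsilon>\<^sup>2 / 3 * ln (real n)"
    by (simp add: \<theta>_def power2_eq_square)
  finally show ?thesis
    using spine_lower[OF q, of \<theta> m r n k] \<theta> by (simp add: a_def)
qed

text \<open>If \<open>n (1 - q)\<close> exceeds a large multiple of \<open>ln n\<close>, the right spine alone is high enough. Otherwise the spine is
  followed down to a subtree of \<open>k\<close> entries, with \<open>k\<close> close to \<open>n powr (1 - e)\<close>. For such a tree \<open>k (1 - q)\<close> tends to \<open>0\<close>; its
  subtrees of size \<open>M n\<close>, about \<open>n powr (1 - 2 * e)\<close>, have height \<open>c ln n\<close> up to a factor close to \<open>1\<close>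
  with positive probability, and \<open>d n\<close> applications of the boosting step make this probability tend to \<open>1\<close>.\<close>
lemma height_lower_tail:
  fixes \<epsilon> \<eta> :: real
  assumes \<epsilon>: "0 < \<epsilon>" "\<epsilon> \<le> 1" and \<eta>: "\<eta> > 0"
  shows "eventually (\<lambda>n. \<forall>q m. 0 \<le> q \<longrightarrow> q \<le> 1 \<longrightarrow>
           real m \<le> (1 - \<epsilon>) * height_scale n q \<longrightarrow> height_cdf q m n \<le> \<eta>) sequentially"
proof -
  define e where "e = \<epsilon> / 10"
  have e: "0 < e" "e \<le> 1 / 10" using \<epsilon> by (auto simp: e_def)
  define c where "c = max 2 (c_star * (1 - e))"
  have c: "2 \<le> c" "c < c_star" "c_star * (1 - e) \<le> c"
    using c_star_gt_2 e by (auto simp: c_def algebra_simps)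
  obtain \<eta>0 \<delta> K where \<eta>0: "0 < \<eta>0" and \<delta>: "0 < \<delta>" and pos:
    "\<And>q n m. 0 \<le> q \<Longrightarrow> q \<le> 1 \<Longrightarrow> real n * (1 - q) \<le> \<delta> \<Longrightarrow> real m \<le> c * ln (real n) - K \<Longrightarrow>
       \<eta>0 \<le> height_tail q m n"
    using height_tail_positive[OF c(1,2)] by blast
  \<comment> \<open>Beyond \<open>n (1 - q) = A * ln n\<close>, the term \<open>c_star * ln n\<close> is only a proportion \<open>e\<close> of \<open>n (1 - q)\<close>.\<close>
  define A where "A = c_star / e"
  have A: "A > 0" using c_star_gt_2 e by (simp add: A_def)
  define d where "d = (\<lambda>n::nat. nat \<lfloor>e * ln (real n) / ln 4\<rfloor>)"
  define M where "M = (\<lambda>n::nat. nat \<lfloor>real n powr (1 - 2 * e)\<rfloor>)"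
  have \<eta>0_le: "\<eta>0 \<le> 1"
  proof -
    obtain n :: nat where n: "K \<le> c * ln (real n)"
    proof -
      have "eventually (\<lambda>n::nat. K \<le> c * ln (real n)) sequentially"
        using c by real_asymp
      then show ?thesis
        using that by (metis (mono_tags, lifting) eventually_happens trivial_limit_sequentially)
    qed
    then have "\<eta>0 \<le> height_tail 1 0 n"
      using \<delta> by (intro pos) auto
    then show ?thesis by (simp add: height_tail_def)
  qed
  have E1: "eventually (\<lambda>n. real n powr (1 - 3 * e) \<le> real n powr (1 - 2 * e) - 1) sequentially"
    using e by real_asymp
  have E2: "eventually (\<lambda>n. real n powr (1 - e) \<le> e * real n) sequentially"
    using e by real_asymp
  have E3: "eventually (\<lambda>n. real n powr (- e) * (A * ln (real n)) < min \<delta> (1 / 2)) sequentially"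
  proof (rule order_tendstoD(2))
    show "(\<lambda>n. real n powr (- e) * (A * ln (real n))) \<longlonglongrightarrow> 0"
      using e by real_asymp
  qed (use \<delta> in auto)
  have E4: "eventually (\<lambda>n. (1 - \<eta>0 / 4) ^ d n < \<eta> / 2) sequentially"
  proof (rule order_tendstoD(2))
    have "filterlim (\<lambda>n. e * ln (real n) / ln 4) at_top sequentially"
      using e by real_asymp
    then have "filterlim d at_top sequentially"
      unfolding d_def
      by (intro filterlim_compose[OF filterlim_nat_sequentially]
                filterlim_compose[OF filterlim_floor_sequentially])
    moreover have "(\<lambda>k. (1 - \<eta>0 / 4) ^ k) \<longlonglongrightarrow> 0"
      using \<eta>0 \<eta>0_le by (intro LIMSEQ_power_zero) auto
    ultimately show "(\<lambda>n. (1 - \<eta>0 / 4) ^ d n) \<longlonglongrightarrow> 0"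
      using filterlim_compose by blast
  qed (use \<eta> in auto)
  have E5: "eventually (\<lambda>n. exp (- (e\<^sup>2 / 3 * ln (real n))) < \<eta> / 2) sequentially"
  proof (rule order_tendstoD(2))
    have "e\<^sup>2 / 3 > 0" using e by simp
    then show "(\<lambda>n. exp (- (e\<^sup>2 / 3 * ln (real n)))) \<longlonglongrightarrow> 0"
      by real_asymp
  qed (use \<eta> in auto)
  have E6: "eventually (\<lambda>n. (\<bar>K\<bar> + 2) / e \<le> ln (real n)) sequentially"
    by real_asymp
  from E1 E2 E3 E4 E5 E6 eventually_gt_at_top[of 0] show ?thesis
  proof eventually_elim
    case (elim n)
    define l where "l = ln (real n)"
    have n: "n > 0" by fact
    have l: "e * l \<ge> \<bar>K\<bar> + 2"
      using elim(6) e by (simp add: l_def field_simps)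
    have l1: "l \<ge> 1"
    proof -
      have "e * l \<le> 1 * l"
        using e ln_real_nonneg[of n] by (intro mult_right_mono) (auto simp: l_def)
      then show ?thesis using l by simp
    qed
    show ?case
    proof (intro allI impI)
      fix q :: real and m :: nat
      assume q: "0 \<le> q" "q \<le> 1" and m: "real m \<le> (1 - \<epsilon>) * height_scale n q"
      define x where "x = real n * (1 - q)"
      have x: "x \<ge> 0" using q by (simp add: x_def)
      have m': "real m \<le> (1 - 10 * e) * (x + c_star * l)"
        using m by (simp add: height_scale_def x_def l_def e_def)
      define r where "r = nat \<lfloor>(1 - 2 * e) * (real n * (1 - q)) - e * ln (real n)\<rfloor>"
      have r: "real r \<ge> (1 - 2 * e) * x - e * l - 1"
        unfolding r_def x_def l_def by linarith
      show "height_cdf q m n \<le> \<eta>"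
      proof (cases "x \<le> A * l")
        case False
        have big: "e * x > c_star * l"
          using False e by (simp add: A_def field_simps)
        have "real m \<le> (1 - 10 * e) * (x + e * x)"
          using m' big e by (elim order_trans) (intro mult_left_mono, auto)
        also have "\<dots> \<le> (1 - 2 * e) * x - e * l - 1"
        proof -
          have "2 * l \<le> c_star * l"
            using c_star_gt_2 l1 by (intro mult_right_mono) auto
          then have "2 * l \<le> e * x" using big by simp
          then have "l + 1 \<le> e * x" using l1 by simp
          moreover have "e * l \<le> l" using e l1 by simp
          moreover have "0 \<le> 10 * (e * (e * x))" using e x by simp
          moreover have "0 \<le> 7 * (e * x)" using e x by simp
          ultimately show ?thesis by (simp add: algebra_simps)
        qed
        also have "\<dots> \<le> real r" by (rule r)
        finally have mr: "m \<le> 0 + r" by simp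
        have "height_cdf q m n \<le> height_cdf q (0 + r) n"
          by (rule height_cdf_mono[OF q(1) mr])
        also have "\<dots> \<le> height_cdf q 0 0 + exp (- (e\<^sup>2 / 3 * ln (real n)))"
          unfolding r_def using e by (intro spine_lower_bound q) auto
        also have "\<dots> \<le> \<eta>"
          using elim(5) \<eta> by simp
        finally show ?thesis .
      next
        case True
        define k where "k = 4 ^ d n * M n"
        have M_le: "real (M n) \<le> real n powr (1 - 2 * e)"
          unfolding M_def by simp
        have M_ge: "real n powr (1 - 3 * e) \<le> real (M n)"
        proof -
          have "real n powr (1 - 2 * e) - 1 \<le> real (M n)"
            unfolding M_def by linarith
          then show ?thesis using elim(1) by linarith
        qed
        have M_pos: "M n > 0"
        proof -
          have "0 < real n powr (1 - 3 * e)" using n by simp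
          then show ?thesis using M_ge by (cases "M n") auto
        qed
        have lnM: "(1 - 3 * e) * l \<le> ln (real (M n))"
        proof -
          have "ln (real n powr (1 - 3 * e)) \<le> ln (real (M n))"
            using M_ge n by (intro ln_mono) auto
          then show ?thesis using n by (simp add: ln_powr l_def)
        qed
        have d_le: "4 ^ d n \<le> real n powr e"
        proof -
          have "real (d n) \<le> e * l / ln 4"
            using e l1 unfolding d_def l_def by (intro of_nat_floor) auto
          then have "real (d n) * ln 4 \<le> e * l"
            by (simp add: pos_le_divide_eq)
          then have "exp (real (d n) * ln 4) \<le> exp (e * l)"
            by simp
          then show ?thesis
            using n by (simp add: exp_of_nat_mult powr_def l_def)
        qed
        have k_le: "real k \<le> real n powr (1 - e)"
        proof -
          have "real k \<le> real n powr e * real n powr (1 - 2 * e)"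
            unfolding k_def using d_le M_le by (simp add: mult_mono)
          also have "\<dots> = real n powr (1 - e)"
            by (simp flip: powr_add)
          finally show ?thesis .
        qed
        have kx: "real k * (1 - q) \<le> min \<delta> (1 / 2)"
        proof -
          have "real k * (1 - q) \<le> real n powr (1 - e) * (1 - q)"
            using k_le q by (intro mult_right_mono) auto
          also have "\<dots> = real n powr (- e) * x"
            using n by (simp add: x_def powr_diff powr_minus field_simps)
          also have "\<dots> \<le> real n powr (- e) * (A * l)"
            using True by (intro mult_left_mono) auto
          finally show ?thesis using elim(3) by (simp add: l_def)
        qed
        have Mx: "real (M n) * (1 - q) \<le> \<delta>"
        proof -
          have "M n \<le> k" by (simp add: k_def)
          then have "real (M n) * (1 - q) \<le> real k * (1 - q)"
            using q by (intro mult_right_mono) auto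
          then show ?thesis using kx by simp
        qed
        define m1 where "m1 = nat \<lfloor>c * ln (real (M n)) - K\<rfloor>"
        have cM: "c * ln (real (M n)) \<ge> c_star * (1 - 4 * e) * l"
        proof -
          have "c_star * (1 - 4 * e) \<le> c_star * ((1 - e) * (1 - 3 * e))"
            using c_star_gt_2 e by (intro mult_left_mono) (auto simp: algebra_simps)
          then have "c_star * (1 - 4 * e) * l \<le> c_star * ((1 - e) * (1 - 3 * e)) * l"
            using l1 by (intro mult_right_mono) auto
          also have "\<dots> = (c_star * (1 - e)) * ((1 - 3 * e) * l)"
            by (simp add: mult_ac)
          also have "\<dots> \<le> c * ln (real (M n))"
            using c lnM e l1 by (intro mult_mono) auto
          finally show ?thesis .
        qed
        have el: "e * l \<le> e * (c_star * l)"
          using c_star_gt_2 e l1 by simp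
        have cM0: "c * ln (real (M n)) - K \<ge> 0"
        proof -
          have "e * (c_star * l) \<le> (1 - 4 * e) * (c_star * l)"
            using e c_star_gt_2 l1 by (intro mult_right_mono) auto
          then show ?thesis using cM el l by (simp add: algebra_simps)
        qed
        have m1: "real m1 \<le> c * ln (real (M n)) - K" "real m1 \<ge> c * ln (real (M n)) - K - 1"
          using cM0 unfolding m1_def by (auto intro: of_nat_floor)
        have "real m \<le> (1 - 10 * e) * (x + c_star * l)" by (rule m')
        also have "\<dots> \<le> c_star * (1 - 4 * e) * l - K - 1 + ((1 - 2 * e) * x - e * l - 1)"
        proof -
          have "0 \<le> 8 * (e * x)" using e x by simp
          moreover have "\<bar>K\<bar> + 2 + e * l \<le> 6 * (e * (c_star * l))"
            using l el by linarith
          ultimately show ?thesis by (simp add: algebra_simps)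
        qed
        also have "\<dots> \<le> real (m1 + r)"
          using m1(2) cM r by simp
        finally have mr: "m \<le> m1 + r" by (simp only: of_nat_le_iff)
        have "height_cdf q m n \<le> height_cdf q (m1 + r) n"
          by (rule height_cdf_mono[OF q(1) mr])
        also have "\<dots> \<le> height_cdf q m1 k + exp (- (e\<^sup>2 / 3 * ln (real n)))"
          unfolding r_def using e k_le elim(2) by (intro spine_lower_bound q) auto
        also have "height_cdf q m1 k \<le> (1 - \<eta>0 / 4) ^ d n"
          unfolding k_def
        proof (rule height_cdf_boost[OF q M_pos])
          show "\<eta>0 \<le> height_tail q m1 (M n)"
            by (rule pos[OF q Mx m1(1)])
          show "real (4 ^ d n * M n) * (1 - q) \<le> 1 / 2"
            using kx by (simp add: k_def)
        qed (use \<eta>0 in auto)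
        finally show ?thesis using elim(4,5) by simp
      qed
    qed
  qed
qed

section \<open>Convergence of the normalised height\<close>
lemma prob_mallows_tree:
  "measure_pmf.prob (mallows_tree n q) {T. P (tree_height T)} =
     measure_pmf.prob (mallows n q) {\<sigma>. P (levels (map \<sigma> [1..<Suc n]) - 1)}"
  unfolding mallows_tree_def
  by (simp add: tree_height_search_tree vimage_def del: upt_Suc)

lemma prob_tree_height_less:
  assumes "q \<ge> 0"
  shows "measure_pmf.prob (mallows_tree n q) {T. tree_height T < m} \<le> height_cdf q (Suc m) n"
  unfolding prob_mallows_tree[where P = "\<lambda>h. h < m"] prob_mallows_levels_less[OF assms, symmetric]
  by (intro measure_pmf.finite_measure_mono) auto

lemma prob_tree_height_ge:
  assumes "q \<ge> 0"
  shows "measure_pmf.prob (mallows_tree n q) {T. m \<le> tree_height T} \<le> height_tail q m n"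
proof -
  have "measure_pmf.prob (mallows_tree n q) {T. m \<le> tree_height T} \<le>
        measure_pmf.prob (mallows n q) (UNIV - {\<sigma>. levels (map \<sigma> [1..<Suc n]) < m})"
    unfolding prob_mallows_tree[where P = "\<lambda>h. m \<le> h"]
    by (intro measure_pmf.finite_measure_mono) auto
  also have "\<dots> = 1 - height_cdf q m n"
    using measure_pmf.prob_compl[of "{\<sigma>. levels (map \<sigma> [1..<Suc n]) < m}" "mallows n q"]
    unfolding prob_mallows_levels_less[OF assms, symmetric] by simp
  finally show ?thesis
    by (simp add: height_tail_def)
qed

lemma finite_set_mallows:
  assumes "q \<ge> 0"
  shows "finite (set_pmf (mallows n q))"
proof (rule finite_subset)
  show "set_pmf (mallows n q) \<subseteq> {\<sigma>. \<sigma> permutes {1..n}}"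
    by (auto simp: set_pmf_eq pmf_mallows[OF assms] split: if_splits)
qed (simp add: finite_permutations)

lemma finite_set_mallows_tree: "q \<ge> 0 \<Longrightarrow> finite (set_pmf (mallows_tree n q))"
  by (simp add: mallows_tree_def finite_set_mallows)

lemma tree_height_le:
  assumes "T \<in> set_pmf (mallows_tree n q)"
  shows "tree_height T \<le> n"
proof -
  obtain \<sigma> where "T = search_tree (map \<sigma> [1..<Suc n])"
    using assms by (auto simp: mallows_tree_def)
  then show ?thesis
    using levels_le_length[of "map \<sigma> [1..<Suc n]"] by (simp add: tree_height_search_tree del: upt_Suc)
qed

lemma height_ratio_concentrated:
  fixes q :: "nat \<Rightarrow> real"
  assumes q: "\<And>n. q n \<in> {0..1}" and \<epsilon>: "\<epsilon> > 0"
  shows "(\<lambda>n. measure_pmf.prob (mallows_tree n (q n))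
            {T. \<bar>real (tree_height T) / height_scale n (q n) - 1\<bar> > \<epsilon>}) \<longlonglongrightarrow> 0"
proof (rule LIMSEQ_I)
  fix r :: real assume r: "r > 0"
  define e where "e = min \<epsilon> 1"
  have e: "0 < e" "e \<le> 1" "e \<le> \<epsilon>" using \<epsilon> by (auto simp: e_def)
  define \<eta> where "\<eta> = r / 3"
  have \<eta>: "\<eta> > 0" using r by (simp add: \<eta>_def)
  obtain L0 where L0: "\<And>q n m. 0 \<le> q \<Longrightarrow> q \<le> 1 \<Longrightarrow> n > 0 \<Longrightarrow> height_scale n q \<ge> L0 \<Longrightarrow>
       (1 + e) * height_scale n q \<le> real m \<Longrightarrow> height_tail q m n \<le> \<eta>"
    using height_upper_tail[OF e(1,2) \<eta>] by blast
  have "eventually (\<lambda>n. \<forall>q m. 0 \<le> q \<longrightarrow> q \<le> 1 \<longrightarrow>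
           real m \<le> (1 - e / 2) * height_scale n q \<longrightarrow> height_cdf q m n \<le> \<eta>) sequentially"
    using e \<eta> by (intro height_lower_tail) auto
  moreover have "eventually (\<lambda>n. max L0 (4 / e) \<le> ln (real n)) sequentially"
    by real_asymp
  ultimately have "eventually (\<lambda>n. measure_pmf.prob (mallows_tree n (q n))
            {T. \<bar>real (tree_height T) / height_scale n (q n) - 1\<bar> > \<epsilon>} < r) sequentially"
    using eventually_gt_at_top[of 0]
  proof eventually_elim
    case (elim n)
    have qn: "0 \<le> q n" "q n \<le> 1" using q[of n] by auto
    define L where "L = height_scale n (q n)"
    have L: "L \<ge> L0" "L \<ge> 4 / e"
      using elim(2) height_scale_ge(3)[OF qn(2), of n] by (auto simp: L_def)
    have L4: "e * L \<ge> 4" using L(2) e by (simp add: field_simps)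
    have L_pos: "L > 0" using L(2) e by (smt (verit) divide_pos_pos)
    define a b where "a = nat \<lceil>(1 + e) * L\<rceil>" and "b = nat \<lceil>(1 - e) * L\<rceil>"
    have a: "(1 + e) * L \<le> real a"
      by (simp add: a_def real_nat_ceiling_ge)
    have b: "(1 - e) * L \<le> real b" "real b \<le> (1 - e) * L + 1"
      using e L_pos by (simp_all add: b_def real_nat_ceiling_ge of_int_ceiling_le_add_one)
    have sub: "{T. \<bar>real (tree_height T) / L - 1\<bar> > \<epsilon>} \<subseteq> {T. a \<le> tree_height T} \<union> {T. tree_height T < b}"
    proof
      fix T assume "T \<in> {T. \<bar>real (tree_height T) / L - 1\<bar> > \<epsilon>}"
      then have "\<bar>real (tree_height T) / L - 1\<bar> > e" using e by simp
      then have "real (tree_height T) / L > 1 + e \<or> real (tree_height T) / L < 1 - e"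
        by linarith
      then have "real (tree_height T) > (1 + e) * L \<or> real (tree_height T) < (1 - e) * L"
        using L_pos by (simp add: pos_less_divide_eq pos_divide_less_eq)
      then have "a \<le> tree_height T \<or> tree_height T < b"
        unfolding a_def b_def by linarith
      then show "T \<in> {T. a \<le> tree_height T} \<union> {T. tree_height T < b}" by simp
    qed
    have "measure_pmf.prob (mallows_tree n (q n)) {T. \<bar>real (tree_height T) / L - 1\<bar> > \<epsilon>} \<le>
          measure_pmf.prob (mallows_tree n (q n)) ({T. a \<le> tree_height T} \<union> {T. tree_height T < b})"
      by (intro measure_pmf.finite_measure_mono sub) auto
    also have "\<dots> \<le> measure_pmf.prob (mallows_tree n (q n)) {T. a \<le> tree_height T} +
          measure_pmf.prob (mallows_tree n (q n)) {T. tree_height T < b}"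
      by (intro measure_subadditive) auto
    also have "\<dots> \<le> height_tail (q n) a n + height_cdf (q n) (Suc b) n"
      by (intro add_mono prob_tree_height_ge prob_tree_height_less qn)
    also have "height_tail (q n) a n \<le> \<eta>"
      using elim(3) L(1) a by (intro L0 qn) (auto simp: L_def)
    also have "height_cdf (q n) (Suc b) n \<le> \<eta>"
    proof -
      have "real (Suc b) \<le> (1 - e / 2) * L"
        using b(2) L4 by (simp add: algebra_simps)
      then show ?thesis
        using elim(1) qn by (simp add: L_def del: height_cdf.simps)
    qed
    finally show ?case
      using r by (simp add: L_def \<eta>_def)
  qed
  then show "\<exists>no. \<forall>n\<ge>no. norm (measure_pmf.prob (mallows_tree n (q n))
            {T. \<bar>real (tree_height T) / height_scale n (q n) - 1\<bar> > \<epsilon>} - 0) < r"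
    by (simp add: eventually_sequentially)
qed

text \<open>The three summands bound the contributions of deviations up to \<open>\<epsilon>\<close>, of larger deviations with ratio at most \<open>B\<close>, and of ratios
  beyond \<open>B\<close>. The last event has probability at most \<open>n powr - (p + 1)\<close>, while the ratio never exceeds \<open>n\<close>.\<close>
lemma height_ratio_moment_bound:
  fixes p :: real
  assumes p: "p > 0"
  obtains C where "C \<ge> 0"
    "\<And>q n \<epsilon>. 0 \<le> q \<Longrightarrow> q \<le> 1 \<Longrightarrow> ln (real n) \<ge> 1 \<Longrightarrow> \<epsilon> > 0 \<Longrightarrow>
       measure_pmf.expectation (mallows_tree n q) (\<lambda>T. \<bar>real (tree_height T) / height_scale n q - 1\<bar> powr p)
       \<le> \<epsilon> powr p + C * measure_pmf.prob (mallows_tree n q)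
                            {T. \<bar>real (tree_height T) / height_scale n q - 1\<bar> > \<epsilon>} + 1 / real n"
proof -
  obtain \<rho> \<gamma> where \<rho>: "\<rho> > 0" and tail: "\<And>q n m. 0 \<le> q \<Longrightarrow> q \<le> 1 \<Longrightarrow> n > 0 \<Longrightarrow>
       height_tail q (Suc m) n \<le> exp (\<gamma> * height_scale n q - \<rho> * real m)"
    using height_tail_large_deviation by blast
  \<comment> \<open>Large enough that \<open>exp (\<gamma> L - \<rho> (B L - 1)) \<le> exp (- (p + 1) L)\<close> for \<open>L \<ge> 1\<close>.\<close>
  define B where "B = (\<bar>\<gamma>\<bar> + \<rho> + p + 1) / \<rho> + 1"
  have B: "B \<ge> 1" "\<rho> * B \<ge> \<bar>\<gamma>\<bar> + \<rho> + p + 1"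
    using \<rho> p by (auto simp: B_def field_simps)
  define C where "C = (B + 1) powr p"
  show thesis
  proof (rule that[of C])
    show "C \<ge> 0" by (simp add: C_def)
    fix q \<epsilon> :: real and n :: nat
    assume q: "0 \<le> q" "q \<le> 1" and n1: "ln (real n) \<ge> 1" and \<epsilon>: "\<epsilon> > 0"
    define L where "L = height_scale n q"
    have L: "L \<ge> ln (real n)" "L \<ge> 1"
      using height_scale_ge(3)[OF q(2), of n] n1 by (auto simp: L_def)
    have n: "n > 0" using n1 by (cases n) auto
    define P where "P = mallows_tree n q"
    define X where "X = (\<lambda>T. real (tree_height T) / L)"
    define m where "m = nat \<lfloor>B * L\<rfloor>"
    define E1 E2 where "E1 = {T. \<bar>X T - 1\<bar> > \<epsilon>}" and "E2 = {T. Suc m \<le> tree_height T}"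
    have fin: "finite (set_pmf P)" by (simp add: P_def finite_set_mallows_tree q)
    have m: "real m \<ge> B * L - 1"
      unfolding m_def by linarith
    have pointwise: "\<bar>X T - 1\<bar> powr p \<le> \<epsilon> powr p + C * indicator E1 T + real n powr p * indicator E2 T"
      if T: "T \<in> set_pmf P" for T
    proof -
      have X0: "X T \<ge> 0" using L by (simp add: X_def)
      consider "T \<notin> E1" | "T \<in> E1" "T \<notin> E2" | "T \<in> E2" by blast
      then show ?thesis
      proof cases
        case 1
        then have "\<bar>X T - 1\<bar> powr p \<le> \<epsilon> powr p"
          using p \<epsilon> by (intro powr_mono2) (auto simp: E1_def)
        then show ?thesis by (simp add: C_def add_increasing2 indicator_def)
      next
        case 2
        then have "tree_height T \<le> m" by (simp add: E2_def)
        then have "real (tree_height T) \<le> B * L"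
          using L B unfolding m_def by (simp add: le_nat_iff le_floor_iff)
        then have "X T \<le> B" using L by (simp add: X_def pos_divide_le_eq)
        then have "\<bar>X T - 1\<bar> \<le> B + 1" using X0 by linarith
        then have "\<bar>X T - 1\<bar> powr p \<le> C"
          unfolding C_def using p by (intro powr_mono2) auto
        then show ?thesis using 2 by (simp add: add_increasing)
      next
        case 3
        have "real (tree_height T) \<ge> B * L"
          using 3 m by (simp add: E2_def m_def)
        moreover have "B * L \<ge> 1 * L" using B L by (intro mult_right_mono) auto
        ultimately have "L \<le> real (tree_height T)" by linarith
        then have X1: "X T \<ge> 1" using L by (simp add: X_def le_divide_eq)
        have "X T \<le> real (tree_height T)"
          using L by (simp add: X_def divide_le_eq mult_le_cancel_left1)
        also have "\<dots> \<le> real n"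
          using tree_height_le[of T n q] T by (simp add: P_def)
        finally have "\<bar>X T - 1\<bar> \<le> real n" using X1 by linarith
        then have "\<bar>X T - 1\<bar> powr p \<le> real n powr p"
          using p by (intro powr_mono2) auto
        moreover have "0 \<le> \<epsilon> powr p + C * indicator E1 T" by (simp add: C_def)
        ultimately show ?thesis using 3 by simp
      qed
    qed
    have int: "integrable (measure_pmf P) f" for f :: "node set \<Rightarrow> real"
      by (rule integrable_measure_pmf_finite[OF fin])
    have "measure_pmf.expectation P (\<lambda>T. \<bar>X T - 1\<bar> powr p) \<le>
          measure_pmf.expectation P (\<lambda>T. \<epsilon> powr p + C * indicator E1 T + real n powr p * indicator E2 T)"
      by (intro integral_mono_AE int) (simp add: AE_measure_pmf_iff pointwise)
    also have "\<dots> = \<epsilon> powr p + C * measure_pmf.prob P E1 + real n powr p * measure_pmf.prob P E2"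
      by (subst Bochner_Integration.integral_add[OF int int])+ simp
    also have "real n powr p * measure_pmf.prob P E2 \<le> real n powr p * real n powr (- (p + 1))"
    proof (intro mult_left_mono)
      have "measure_pmf.prob P E2 \<le> height_tail q (Suc m) n"
        unfolding P_def E2_def by (rule prob_tree_height_ge[OF q(1)])
      also have "\<dots> \<le> exp (\<gamma> * L - \<rho> * real m)"
        unfolding L_def by (rule tail[OF q n])
      also have "\<gamma> * L - \<rho> * real m \<le> - (p + 1) * ln (real n)"
      proof -
        have "\<rho> * (B * L - 1) \<le> \<rho> * real m"
          using m \<rho> by (intro mult_left_mono) auto
        moreover have "(\<bar>\<gamma>\<bar> + \<rho> + p + 1) * L \<le> \<rho> * B * L"
          using B L by (intro mult_right_mono) auto
        moreover have "\<gamma> * L \<le> \<bar>\<gamma>\<bar> * L"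
          using L by (intro mult_right_mono) auto
        moreover have "\<rho> * 1 \<le> \<rho> * L"
          using L \<rho> by (intro mult_left_mono) auto
        moreover have "(p + 1) * ln (real n) \<le> (p + 1) * L"
          using L p by (intro mult_left_mono) auto
        ultimately show ?thesis by (simp add: algebra_simps)
      qed
      finally show "measure_pmf.prob P E2 \<le> real n powr (- (p + 1))"
        using n by (simp add: powr_def)
    qed auto
    also have "real n powr p * real n powr (- (p + 1)) = 1 / real n"
      using n by (simp flip: powr_add add: powr_minus_divide)
    finally show "measure_pmf.expectation (mallows_tree n q) (\<lambda>T. \<bar>real (tree_height T) / height_scale n q - 1\<bar> powr p)
       \<le> \<epsilon> powr p + C * measure_pmf.prob (mallows_tree n q)
                            {T. \<bar>real (tree_height T) / height_scale n q - 1\<bar> > \<epsilon>} + 1 / real n"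
      by (simp add: P_def X_def E1_def L_def)
  qed
qed

lemma height_ratio_Lp:
  fixes q :: "nat \<Rightarrow> real"
  assumes q: "\<And>n. q n \<in> {0..1}" and p: "p > 0"
  shows "(\<lambda>n. measure_pmf.expectation (mallows_tree n (q n))
            (\<lambda>T. \<bar>real (tree_height T) / height_scale n (q n) - 1\<bar> powr p)) \<longlonglongrightarrow> 0"
proof (rule LIMSEQ_I)
  fix r :: real assume r: "r > 0"
  obtain C where C: "C \<ge> 0"
    "\<And>q n \<epsilon>. 0 \<le> q \<Longrightarrow> q \<le> 1 \<Longrightarrow> ln (real n) \<ge> 1 \<Longrightarrow> \<epsilon> > 0 \<Longrightarrow>
       measure_pmf.expectation (mallows_tree n q) (\<lambda>T. \<bar>real (tree_height T) / height_scale n q - 1\<bar> powr p)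
       \<le> \<epsilon> powr p + C * measure_pmf.prob (mallows_tree n q)
                            {T. \<bar>real (tree_height T) / height_scale n q - 1\<bar> > \<epsilon>} + 1 / real n"
    using height_ratio_moment_bound[OF p] by blast
  define \<epsilon> where "\<epsilon> = (r / 3) powr (1 / p)"
  have \<epsilon>: "\<epsilon> > 0" "\<epsilon> powr p = r / 3" using r p by (auto simp: \<epsilon>_def powr_powr)
  have "(\<lambda>n. C * measure_pmf.prob (mallows_tree n (q n))
            {T. \<bar>real (tree_height T) / height_scale n (q n) - 1\<bar> > \<epsilon>}) \<longlonglongrightarrow> C * 0"
    by (intro tendsto_mult_left height_ratio_concentrated q \<epsilon>)
  then have "eventually (\<lambda>n. C * measure_pmf.prob (mallows_tree n (q n))
            {T. \<bar>real (tree_height T) / height_scale n (q n) - 1\<bar> > \<epsilon>} < r / 3) sequentially"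
    by (rule order_tendstoD(2)) (use r in simp)
  moreover have "eventually (\<lambda>n. 1 / real n < r / 3) sequentially"
    using r by real_asymp
  moreover have "eventually (\<lambda>n. 1 \<le> ln (real n)) sequentially"
    by real_asymp
  ultimately have "eventually (\<lambda>n. measure_pmf.expectation (mallows_tree n (q n))
            (\<lambda>T. \<bar>real (tree_height T) / height_scale n (q n) - 1\<bar> powr p) < r) sequentially"
  proof eventually_elim
    case (elim n)
    then show ?case
      using C(2)[of "q n" n \<epsilon>] q[of n] \<epsilon> by simp
  qed
  then show "\<exists>no. \<forall>n\<ge>no. norm (measure_pmf.expectation (mallows_tree n (q n))
            (\<lambda>T. \<bar>real (tree_height T) / height_scale n (q n) - 1\<bar> powr p) - 0) < r"
    by (simp add: eventually_sequentially)
qed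

theorem theorem1p1:
  fixes q :: "nat \<Rightarrow> real"
  assumes "\<And>n. q n \<in> {0..1}"
  shows
    "tendsto_in_probability (\<lambda>n. measure_pmf (mallows_tree n (q n)))
       (\<lambda>n T. real (tree_height T) / (real n * (1 - q n) + c_star * ln (real n))) 1
     \<and> (\<forall>p>0. tendsto_in_Lp p (\<lambda>n. measure_pmf (mallows_tree n (q n)))
       (\<lambda>n T. real (tree_height T) / (real n * (1 - q n) + c_star * ln (real n))) 1)"
proof (intro conjI allI impI)
  show "tendsto_in_probability (\<lambda>n. measure_pmf (mallows_tree n (q n)))
       (\<lambda>n T. real (tree_height T) / (real n * (1 - q n) + c_star * ln (real n))) 1"
    unfolding tendsto_in_probability_def
    using height_ratio_concentrated[OF assms] by (simp add: height_scale_def)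
  fix p :: real assume p: "p > 0"
  have "finite (set_pmf (mallows_tree n (q n)))" for n
    using assms[of n] by (intro finite_set_mallows_tree) auto
  then show "tendsto_in_Lp p (\<lambda>n. measure_pmf (mallows_tree n (q n)))
       (\<lambda>n T. real (tree_height T) / (real n * (1 - q n) + c_star * ln (real n))) 1"
    unfolding tendsto_in_Lp_def
    using height_ratio_Lp[OF assms p] by (auto simp: height_scale_def intro: integrable_measure_pmf_finite)
qed

end
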